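(* Let $\boldsymbol{K}=(K_{n,m})$ be a compact rectangular matrix convex set in a topological vector space $V$. Then $\boldsymbol{K}$ is the closed rectangular matrix convex hull of the collection $\partial_\rho\boldsymbol{K}=(\partial_\rho K_{n,m})$ of its rectangular matrix extreme points.
   Context: A rectangular matrix convex set in a complex vector space $V$ is a collection $\boldsymbol{K}=(K_{n,m})_{n,m\in\mathbb{N}}$ of subsets $K_{n,m}\subset M_{n,m}(V)$ with the property that for any $\alpha_i\in M_{n_i,n}(\mathbb{C})$, $\beta_i\in M_{m_i,m}(\mathbb{C})$ and $v_i\in K_{n_i,m_i}$ for $1\le i\le\ell$ such that $\|\alpha_1^*\alpha_1+\cdots+\alpha_\ell^*\alpha_\ell\|\,\|\beta_1^*\beta_1+\cdots+\beta_\ell^*\beta_\ell\|\le1$ one has $\alpha_1^*v_1\beta_1+\cdots+\alpha_\ell^*v_\ell\beta_\ell\in K_{n,m}$. When $V$ is a topological vector space, $\boldsymbol{K}$ is compact (closed) if each $K_{n,m}$ is compact (closed) in $M_{n,m}(V)$. The closed rectangular matrix convex hull of a collection $\boldsymbol{S}=(S_{n,m})$ of subsets $S_{n,m}\subset M_{n,m}(V)$ is the smallest closed rectangular matrix convex set containing $\boldsymbol{S}$ (levelwise). A proper rectangular matrix convex combination in $\boldsymbol{K}$ is an expression $\alpha_1^*v_1\beta_1+\cdots+\alpha_\ell^*v_\ell\beta_\ell$ with $v_i\in K_{n_i,m_i}$, $\alpha_i\in M_{n_i,n}(\mathbb{C})$ and $\beta_i\in M_{m_i,m}(\mathbb{C})$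 right invertible, $\sum_i\alpha_i^*\alpha_i=1$ and $\sum_i\beta_i^*\beta_i=1$. An element $v\in K_{n,m}$ is a rectangular matrix extreme point of $\boldsymbol{K}$ if for any proper rectangular matrix convex combination $\alpha_1^*v_1\beta_1+\cdots+\alpha_\ell^*v_\ell\beta_\ell=v$ with $v_i\in K_{n_i,m_i}$ one has that, for every $1\le i\le\ell$, $n_i=n$, $m_i=m$ and $v_i=u_i^*vw_i$ for some unitaries $u_i\in M_n(\mathbb{C})$ and $w_i\in M_m(\mathbb{C})$. $\partial_\rho K_{n,m}$ denotes the set of rectangular matrix extreme points lying in $K_{n,m}$.
   Formalization: The topological vector space V is taken to be Hausdorff and locally convex; for arbitrary topological vector spaces the statement fails (indiscrete V with K = {0}, or compact convex sets without extreme points as in Roberts' example). *)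

theory Defs
  imports
    "HOL-Analysis.Function_Topology"
    "HOL-Analysis.L2_Norm"
    "Jordan_Normal_Form.Schur_Decomposition"
begin

text \<open>
  Hausdorff locally convex topological vector spaces over the complex numbers. Krein--Milman
  theorems for (matrix) convex sets fail without the Hausdorff property or local convexity.
\<close>

locale locally_convex_tvs = vector_space smul
  for smul :: "complex \<Rightarrow> 'v::{topological_ab_group_add, t2_space} \<Rightarrow> 'v" +
  assumes continuous_scale: "continuous_on UNIV (\<lambda>(c, x). smul c x)"
    and locally_convex: "\<And>U. open U \<Longrightarrow> 0 \<in> U \<Longrightarrow>
      \<exists>W. open W \<and> 0 \<in> W \<and> W \<subseteq> U \<and>
        (\<forall>x\<in>W. \<forall>y\<in>W. \<forall>t\<in>{0..1}. smul (of_real t) x + smul (of_real (1 - t)) y \<in> W)"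

text \<open>The space \<open>M\<^sub>n\<^sub>,\<^sub>m(V)\<close> is \<open>carrier_mat n m\<close>; its topology is the product topology on
  the entries.\<close>

definition mat_topology :: "nat \<Rightarrow> nat \<Rightarrow> 'v::topological_space mat topology" where
  "mat_topology n m = pullback_topology (carrier_mat n m)
     (\<lambda>A. restrict (\<lambda>(i, j). A $$ (i, j)) ({..<n} \<times> {..<m}))
     (product_topology (\<lambda>_. euclidean) ({..<n} \<times> {..<m}))"

definition mat_sum :: "nat \<Rightarrow> nat \<Rightarrow> nat \<Rightarrow> (nat \<Rightarrow> 'a::comm_monoid_add mat) \<Rightarrow> 'a mat" where
  "mat_sum n m l A = mat n m (\<lambda>(i, j). \<Sum>k<l. A k $$ (i, j))"

text \<open>The product \<open>\<alpha>\<^sup>* v \<beta>\<close> of a vector-valued matrix with scalar matrices on both sides.\<close>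

definition compress ::
  "(complex \<Rightarrow> 'v::ab_group_add \<Rightarrow> 'v) \<Rightarrow> complex mat \<Rightarrow> 'v mat \<Rightarrow> complex mat \<Rightarrow> 'v mat" where
  "compress smul \<alpha> v \<beta> = mat (dim_col \<alpha>) (dim_col \<beta>) (\<lambda>(i, j).
     \<Sum>p<dim_row v. \<Sum>q<dim_col v.
       smul (mat_adjoint \<alpha> $$ (i, p) * \<beta> $$ (q, j)) (v $$ (p, q)))"

definition vec_l2_norm :: "complex vec \<Rightarrow> real" where
  "vec_l2_norm x = L2_set (\<lambda>i. norm (x $ i)) {..<dim_vec x}"

definition mat_op_norm :: "complex mat \<Rightarrow> real" where
  "mat_op_norm A = (SUP x\<in>{x \<in> carrier_vec (dim_col A). vec_l2_norm x \<le> 1}. vec_l2_norm (A *\<^sub>v x))"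

definition right_invertible_mat :: "complex mat \<Rightarrow> bool" where
  "right_invertible_mat A \<longleftrightarrow> (\<exists>B \<in> carrier_mat (dim_col A) (dim_row A). inverts_mat A B)"

definition unitary_mat :: "nat \<Rightarrow> complex mat \<Rightarrow> bool" where
  "unitary_mat n u \<longleftrightarrow> u \<in> carrier_mat n n \<and>
     inverts_mat (mat_adjoint u) u \<and> inverts_mat u (mat_adjoint u)"

text \<open>
  A collection \<open>(K\<^sub>n\<^sub>,\<^sub>m)\<close> is a function \<open>nat \<Rightarrow> nat \<Rightarrow> 'v mat set\<close>. Matrix sizes are positive
  throughout, so the values of such a function at a zero index are ignored.
\<close>

definition collection_le ::
  "(nat \<Rightarrow> nat \<Rightarrow> 'v mat set) \<Rightarrow> (nat \<Rightarrow> nat \<Rightarrow> 'v mat set) \<Rightarrow> bool" where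
  "collection_le S T \<longleftrightarrow> (\<forall>n>0. \<forall>m>0. S n m \<subseteq> T n m)"

text \<open>The data of a combination \<open>\<alpha>\<^sub>1\<^sup>* v\<^sub>1 \<beta>\<^sub>1 + \<dots> + \<alpha>\<^sub>l\<^sup>* v\<^sub>l \<beta>\<^sub>l\<close> in \<open>M\<^sub>n\<^sub>,\<^sub>m(V)\<close>
  (indexed from zero), where the coefficients \<open>v\<^sub>k\<close> have size \<open>r k \<times> s k\<close>.\<close>

definition combination_data ::
  "(nat \<Rightarrow> nat \<Rightarrow> 'v mat set) \<Rightarrow> nat \<Rightarrow> nat \<Rightarrow> nat \<Rightarrow> (nat \<Rightarrow> nat) \<Rightarrow> (nat \<Rightarrow> nat) \<Rightarrow>
    (nat \<Rightarrow> complex mat) \<Rightarrow> (nat \<Rightarrow> 'v mat) \<Rightarrow> (nat \<Rightarrow> complex mat) \<Rightarrow> bool" where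
  "combination_data K n m l r s \<alpha> v \<beta> \<longleftrightarrow> l > 0 \<and>
     (\<forall>k<l. r k > 0 \<and> s k > 0 \<and> v k \<in> K (r k) (s k) \<and>
       \<alpha> k \<in> carrier_mat (r k) n \<and> \<beta> k \<in> carrier_mat (s k) m)"

definition rect_matrix_convex ::
  "(complex \<Rightarrow> 'v::ab_group_add \<Rightarrow> 'v) \<Rightarrow> (nat \<Rightarrow> nat \<Rightarrow> 'v mat set) \<Rightarrow> bool" where
  "rect_matrix_convex smul K \<longleftrightarrow> collection_le K carrier_mat \<and>
     (\<forall>n>0. \<forall>m>0. \<forall>l r s \<alpha> v \<beta>.
       combination_data K n m l r s \<alpha> v \<beta> \<and>
       mat_op_norm (mat_sum n n l (\<lambda>k. mat_adjoint (\<alpha> k) * \<alpha> k)) *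
         mat_op_norm (mat_sum m m l (\<lambda>k. mat_adjoint (\<beta> k) * \<beta> k)) \<le> 1 \<longrightarrow>
       mat_sum n m l (\<lambda>k. compress smul (\<alpha> k) (v k) (\<beta> k)) \<in> K n m)"

definition compact_collection :: "(nat \<Rightarrow> nat \<Rightarrow> 'v::topological_space mat set) \<Rightarrow> bool" where
  "compact_collection K \<longleftrightarrow> (\<forall>n>0. \<forall>m>0. compactin (mat_topology n m) (K n m))"

definition closed_collection :: "(nat \<Rightarrow> nat \<Rightarrow> 'v::topological_space mat set) \<Rightarrow> bool" where
  "closed_collection K \<longleftrightarrow> (\<forall>n>0. \<forall>m>0. closedin (mat_topology n m) (K n m))"

definition is_closed_rect_matrix_convex_hull ::
  "(complex \<Rightarrow> 'v::{ab_group_add, topological_space} \<Rightarrow> 'v) \<Rightarrow>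
    (nat \<Rightarrow> nat \<Rightarrow> 'v mat set) \<Rightarrow> (nat \<Rightarrow> nat \<Rightarrow> 'v mat set) \<Rightarrow> bool" where
  "is_closed_rect_matrix_convex_hull smul S K \<longleftrightarrow>
     rect_matrix_convex smul K \<and> closed_collection K \<and> collection_le S K \<and>
     (\<forall>L. rect_matrix_convex smul L \<and> closed_collection L \<and> collection_le S L \<longrightarrow>
       collection_le K L)"

definition proper_combination ::
  "(nat \<Rightarrow> nat \<Rightarrow> 'v mat set) \<Rightarrow> nat \<Rightarrow> nat \<Rightarrow> nat \<Rightarrow> (nat \<Rightarrow> nat) \<Rightarrow> (nat \<Rightarrow> nat) \<Rightarrow>
    (nat \<Rightarrow> complex mat) \<Rightarrow> (nat \<Rightarrow> 'v mat) \<Rightarrow> (nat \<Rightarrow> complex mat) \<Rightarrow> bool" where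
  "proper_combination K n m l r s \<alpha> v \<beta> \<longleftrightarrow>
     combination_data K n m l r s \<alpha> v \<beta> \<and>
     (\<forall>k<l. right_invertible_mat (\<alpha> k) \<and> right_invertible_mat (\<beta> k)) \<and>
     mat_sum n n l (\<lambda>k. mat_adjoint (\<alpha> k) * \<alpha> k) = 1\<^sub>m n \<and>
     mat_sum m m l (\<lambda>k. mat_adjoint (\<beta> k) * \<beta> k) = 1\<^sub>m m"

definition rect_matrix_extreme_points ::
  "(complex \<Rightarrow> 'v::ab_group_add \<Rightarrow> 'v) \<Rightarrow> (nat \<Rightarrow> nat \<Rightarrow> 'v mat set) \<Rightarrow>
    nat \<Rightarrow> nat \<Rightarrow> 'v mat set" where
  "rect_matrix_extreme_points smul K n m = {x \<in> K n m.
     \<forall>l r s \<alpha> v \<beta>. proper_combination K n m l r s \<alpha> v \<beta> \<and>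
       mat_sum n m l (\<lambda>k. compress smul (\<alpha> k) (v k) (\<beta> k)) = x \<longrightarrow>
       (\<forall>k<l. r k = n \<and> s k = m \<and>
         (\<exists>u w. unitary_mat n u \<and> unitary_mat m w \<and> v k = compress smul u x w))}"

end

theory Submission
  imports Defs "HOL-Library.Function_Algebras"
begin

text \<open>
  The Webster--Winkler argument. To \<open>v \<in> K\<^sub>r\<^sub>,\<^sub>s\<close> and scalar matrices \<open>\<alpha>\<close>, \<open>\<beta>\<close> associate the triple
  \<open>(\<alpha>\<^sup>*\<alpha>, \<beta>\<^sup>*\<beta>, \<alpha>\<^sup>*v\<beta>)\<close>. For fixed \<open>n\<close>, \<open>m\<close> the triples with \<open>tr \<alpha>\<^sup>*\<alpha> + tr \<beta>\<^sup>*\<beta> = n + m\<close> form a compact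
  set. An extreme triple with \<open>\<alpha>, \<beta> \<noteq> 0\<close> can be written with right invertible \<open>\<alpha>\<close>, \<open>\<beta>\<close>, and then \<open>v\<close> is a
  rectangular matrix extreme point, since a proper combination equal to \<open>v\<close> decomposes the triple.
  Hence, if \<open>L\<close> is closed and convex and contains the extreme points, the convex cone of sums of
  triples over \<open>L\<close> contains all extreme triples, and its closure contains \<open>(1, 1, v)\<close> for every
  \<open>v \<in> K\<^sub>n\<^sub>,\<^sub>m\<close> by the classical Krein--Milman theorem. Rescaling nearby triples \<open>(A, B, w)\<close> by bounds for
  \<open>\<parallel>A\<parallel>\<close> and \<open>\<parallel>B\<parallel>\<close> puts \<open>w\<close> into \<open>L\<^sub>n\<^sub>,\<^sub>m\<close>, so \<open>v \<in> L\<^sub>n\<^sub>,\<^sub>m\<close>.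
\<close>

subsection \<open>Topological groups of functions and pairs\<close>

text \<open>The obstacle is that extremality involves several levels at once: a proper combination
  equal to \<open>v\<close> may use matrices of smaller sizes, so extremality inside the single set
  \<open>K n m\<close> does not express it. The Gram matrices kept in the triple turn such a
  combination into an ordinary sum of triples at one fixed level. The total n + m is the trace of
  the two identity matrices, and fixing it bounds the entries of the coefficients, which gives
  compactness. Triples with \<alpha> = 0 or \<beta> = 0 have third component 0 and yield no extreme
  point of \<open>K\<close>. They are placed in the cone over \<open>L\<close> by means of zero
  matrices in \<open>L\<close>, which exist once \<open>L\<close> has any element. Hence a nonempty
  \<open>K\<close> must first be shown to have some extreme point. For this the argument is run with
  the collection of zero matrices as \<open>L\<close>: without extreme points \<open>K\<close> would
  contain only zeros, and then the zero matrix of size 1 by 1 would be extreme.\<close>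

instance "fun" :: (type, t2_space) t2_space
proof
  fix f g :: "'a \<Rightarrow> 'b"
  assume "f \<noteq> g"
  then obtain i where "f i \<noteq> g i" by auto
  then obtain U V where UV: "open U" "open V" "f i \<in> U" "g i \<in> V" "U \<inter> V = {}"
    by (meson hausdorff)
  have "open ((\<lambda>h::'a \<Rightarrow> 'b. h i) -` W)" if "open W" for W
    by (rule open_vimage[OF that]) simp
  with UV show "\<exists>U V. open U \<and> open V \<and> f \<in> U \<and> g \<in> V \<and> U \<inter> V = {}"
    by (intro exI[of _ "(\<lambda>h. h i) -` U"] exI[of _ "(\<lambda>h. h i) -` V"]) auto
qed

text \<open>The class axioms below speak of limits along \<open>nhds\<close>. They are derived from
  continuity on the whole space, which for functions can be checked coordinatewise.\<close>

lemma continuous_on_UNIV_tendsto_nhds: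
  "continuous_on UNIV f \<Longrightarrow> (f \<longlongrightarrow> f x) (nhds x)"
  by (simp add: continuous_on_def tendsto_at_iff_tendsto_nhds)

instance "fun" :: (type, topological_monoid_add) topological_monoid_add
proof
  fix a b :: "'a \<Rightarrow> 'b"
  have "continuous_on UNIV (\<lambda>p::('a \<Rightarrow> 'b) \<times> ('a \<Rightarrow> 'b). fst p + snd p)"
    by (rule continuous_on_coordinatewise_then_product)
      (auto intro!: continuous_on_add continuous_on_product_then_coordinatewise[OF continuous_on_fst]
        continuous_on_product_then_coordinatewise[OF continuous_on_snd] continuous_on_id)
  then show "((\<lambda>p. fst p + snd p) \<longlongrightarrow> a + b) (nhds a \<times>\<^sub>F nhds b)"
    using continuous_on_UNIV_tendsto_nhds[where f = "\<lambda>p. fst p + snd p" and x = "(a, b)"]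
    by (simp only: nhds_prod fst_conv snd_conv)
qed

instance "fun" :: (type, topological_group_add) topological_group_add
proof
  fix a :: "'a \<Rightarrow> 'b"
  have "continuous_on UNIV (\<lambda>p::'a \<Rightarrow> 'b. - p)"
    by (rule continuous_on_coordinatewise_then_product)
      (simp add: continuous_on_minus)
  then show "(uminus \<longlongrightarrow> - a) (nhds a)"
    using continuous_on_UNIV_tendsto_nhds[where f = uminus and x = a] by blast
qed

instance "fun" :: (type, topological_ab_group_add) topological_ab_group_add ..

instance prod :: (topological_monoid_add, topological_monoid_add) topological_monoid_add
proof
  fix a b :: "'a \<times> 'b"
  have "continuous_on UNIV (\<lambda>p::('a \<times> 'b) \<times> ('a \<times> 'b). fst p + snd p)"
    unfolding plus_prod_def
    by (intro continuous_on_Pair continuous_on_add continuous_on_fst continuous_on_snd continuous_on_id)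
  then show "((\<lambda>p. fst p + snd p) \<longlongrightarrow> a + b) (nhds a \<times>\<^sub>F nhds b)"
    using continuous_on_UNIV_tendsto_nhds[where f = "\<lambda>p. fst p + snd p" and x = "(a, b)"]
    by (simp only: nhds_prod fst_conv snd_conv)
qed

instance prod :: (topological_group_add, topological_group_add) topological_group_add
proof
  fix a :: "'a \<times> 'b"
  have "continuous_on UNIV (\<lambda>p::'a \<times> 'b. - p)"
    unfolding uminus_prod_def
    by (intro continuous_on_Pair continuous_on_minus continuous_on_fst continuous_on_snd continuous_on_id)
  then show "(uminus \<longlongrightarrow> - a) (nhds a)"
    using continuous_on_UNIV_tendsto_nhds[where f = uminus and x = a] by blast
qed

instance prod :: (topological_ab_group_add, topological_ab_group_add) topological_ab_group_add ..

subsection \<open>The Krein--Milman theorem\<close>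

text \<open>Continuity of scaling in the vector makes dilations open, and continuity in the scalar
  lets the dilation parameter move. Real scalars are all that convexity refers to.\<close>

locale real_lctvs = vector_space sc
  for sc :: "real \<Rightarrow> 'a::{topological_ab_group_add, t2_space} \<Rightarrow> 'a" +
  assumes continuous_on_scale_vector: "continuous_on S (sc a)"
    and continuous_on_scale_scalar: "continuous_on T (\<lambda>a. sc a x)"
    and convex_base: "open U \<Longrightarrow> 0 \<in> U \<Longrightarrow>
      \<exists>W. open W \<and> 0 \<in> W \<and> W \<subseteq> U \<and>
        (\<forall>x\<in>W. \<forall>y\<in>W. \<forall>t\<in>{0..1}. sc t x + sc (1 - t) y \<in> W)"
begin

definition cvx :: "'a set \<Rightarrow> bool" where
  "cvx W \<longleftrightarrow> (\<forall>x\<in>W. \<forall>y\<in>W. \<forall>t\<in>{0..1}. sc t x + sc (1 - t) y \<in> W)"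

text \<open>For \<open>c\<close> > 0 this is the image of \<open>U\<close> under the homothety with
  centre \<open>p\<close> and ratio \<open>c\<close>. If \<open>U\<close> is open, convex and
  contains \<open>p\<close>, it is the set where the gauge of \<open>U\<close> centred at
  \<open>p\<close> is less than \<open>c\<close>. As \<open>1 / 0 = 0\<close>, the value at
  \<open>c = 0\<close> is everything or empty, so the order lemmas ask for positive
  parameters.\<close>

definition dilate :: "'a set \<Rightarrow> 'a \<Rightarrow> real \<Rightarrow> 'a set" where
  "dilate U p c = {z. p + sc (1 / c) (z - p) \<in> U}"

text \<open>Finite combinations replace the usual segments because \<open>C\<close> is not assumed
  convex: a partial combination of points of \<open>C\<close> may leave \<open>C\<close>, so a
  condition on two points would not pass to several. Extreme points of \<open>C\<close> are the
  points \<open>e\<close> with \<open>{e}\<close> extremal.\<close>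

definition extremal :: "'a set \<Rightarrow> 'a set \<Rightarrow> bool" where
  "extremal C E \<longleftrightarrow> E \<subseteq> C \<and>
     (\<forall>(l::nat) t x. (\<forall>i<l. 0 < t i \<and> x i \<in> C) \<and> (\<Sum>i<l. t i) = 1 \<and> (\<Sum>i<l. sc (t i) (x i)) \<in> E \<longrightarrow>
       (\<forall>i<l. x i \<in> E))"

lemma extremalD:
  fixes l :: nat
  assumes "extremal C E" "\<And>i. i < l \<Longrightarrow> 0 < t i" "\<And>i. i < l \<Longrightarrow> x i \<in> C"
    "(\<Sum>i<l. t i) = 1" "(\<Sum>i<l. sc (t i) (x i)) \<in> E" "i < l"
  shows "x i \<in> E"
  using assms unfolding extremal_def by blast

lemma cvxD: "cvx W \<Longrightarrow> x \<in> W \<Longrightarrow> y \<in> W \<Longrightarrow> 0 \<le> t \<Longrightarrow> t \<le> 1 \<Longrightarrow> sc t x + sc (1 - t) y \<in> W"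
  by (simp add: cvx_def)

text \<open>Dividing by the total weight in the statement allows the induction to remove an index
  without changing the remaining weights.\<close>

lemma cvx_sum_normalized:
  assumes U: "cvx U" and I: "finite I" "I \<noteq> {}"
    and a: "\<And>i. i \<in> I \<Longrightarrow> 0 < a i" and u: "\<And>i. i \<in> I \<Longrightarrow> u i \<in> U"
  shows "sc (1 / sum a I) (\<Sum>i\<in>I. sc (a i) (u i)) \<in> U"
  using I a u
proof (induction I rule: finite_ne_induct)
  case (singleton i)
  then show ?case
    using singleton(1)[of i] by simp
next
  case (insert j F)
  define s where "s = sum a F"
  have s: "s > 0"
    unfolding s_def using insert by (intro sum_pos) auto
  have aj: "a j > 0" using insert by simp
  have "sc (1 / s) (\<Sum>i\<in>F. sc (a i) (u i)) \<in> U"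
    unfolding s_def using insert by auto
  then have "sc (a j / (a j + s)) (u j) + sc (1 - a j / (a j + s)) (sc (1 / s) (\<Sum>i\<in>F. sc (a i) (u i))) \<in> U"
    using insert(6)[of j] s aj by (intro cvxD[OF U]) auto
  moreover have "(1 - a j / (a j + s)) * (1 / s) = 1 / (a j + s)"
    using s aj by (simp add: field_simps)
  ultimately have "sc (a j / (a j + s)) (u j) + sc (1 / (a j + s)) (\<Sum>i\<in>F. sc (a i) (u i)) \<in> U"
    by simp
  moreover have "sc (1 / (a j + s)) (sc (a j) (u j) + (\<Sum>i\<in>F. sc (a i) (u i))) =
      sc (a j / (a j + s)) (u j) + sc (1 / (a j + s)) (\<Sum>i\<in>F. sc (a i) (u i))"
    by (simp add: scale_right_distrib)
  moreover have "sum a (insert j F) = a j + s"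
    using insert by (simp add: s_def)
  moreover have "(\<Sum>i\<in>insert j F. sc (a i) (u i)) = sc (a j) (u j) + (\<Sum>i\<in>F. sc (a i) (u i))"
    using insert by simp
  ultimately show ?case
    by simp
qed

lemma cvx_sum:
  assumes U: "cvx U" and I: "finite I" and a1: "sum a I = 1"
    and a: "\<And>i. i \<in> I \<Longrightarrow> 0 < a i" and u: "\<And>i. i \<in> I \<Longrightarrow> u i \<in> U"
  shows "(\<Sum>i\<in>I. sc (a i) (u i)) \<in> U"
proof -
  have "I \<noteq> {}" using a1 by auto
  have "sc (1 / sum a I) (\<Sum>i\<in>I. sc (a i) (u i)) \<in> U"
    by (rule cvx_sum_normalized) (use assms \<open>I \<noteq> {}\<close> in auto)
  then show ?thesis using a1 by simp
qed

lemma dilate_1 [simp]: "dilate U p 1 = U"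
  by (simp add: dilate_def)

lemma open_dilate: "open U \<Longrightarrow> open (dilate U p c)"
proof -
  assume U: "open U"
  have "continuous_on UNIV (\<lambda>z. p + sc (1 / c) (z - p))"
    by (intro continuous_on_add continuous_on_const continuous_on_compose2[OF continuous_on_scale_vector]
        continuous_on_diff continuous_on_id) auto
  then have "open ((\<lambda>z. p + sc (1 / c) (z - p)) -` U)"
    using U by (simp add: open_vimage)
  then show ?thesis
    by (simp add: dilate_def vimage_def)
qed

text \<open>The point scaled by \<open>1 / d\<close> lies on the segment between \<open>p\<close>
  and the point scaled by \<open>1 / c\<close>, with weight \<open>c / d\<close> on the
  latter.\<close>

lemma dilate_mono:
  assumes U: "cvx U" "p \<in> U" and c: "0 < c" "c \<le> d"
  shows "dilate U p c \<subseteq> dilate U p d"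
proof
  fix z assume z: "z \<in> dilate U p c"
  have "sc (c / d) (p + sc (1 / c) (z - p)) + sc (1 - c / d) p \<in> U"
    using c z U by (intro cvxD[OF U(1)]) (auto simp: dilate_def)
  moreover have "sc (c / d) (p + sc (1 / c) (z - p)) + sc (1 - c / d) p = p + sc (1 / d) (z - p)"
    using c by (simp add: scale_right_distrib scale_left_diff_distrib)
  ultimately show "z \<in> dilate U p d"
    by (simp add: dilate_def)
qed

lemma open_dilation_parameters:
  assumes "open U"
  shows "open {s. p + sc s (z - p) \<in> U}"
proof -
  have "continuous_on UNIV (\<lambda>s. p + sc s (z - p))"
    by (intro continuous_on_add continuous_on_const continuous_on_scale_scalar)
  then have "open ((\<lambda>s. p + sc s (z - p)) -` U)"
    using assms by (simp add: open_vimage)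
  then show ?thesis
    by (simp add: vimage_def)
qed

text \<open>The parameter \<open>s\<close> is the inverse of a ratio, so that \<open>s = 0\<close>,
  where the scaled point is \<open>p\<close> itself, is included. This case shows that the dilations
  absorb every point.\<close>

lemma mem_dilate_increase_parameter:
  assumes U: "open U" and s: "0 \<le> s" "p + sc s (z - p) \<in> U"
  obtains r where "s < r" "z \<in> dilate U p (1 / r)"
proof -
  obtain e where e: "e > 0" "\<And>y. dist y s < e \<Longrightarrow> p + sc y (z - p) \<in> U"
    using open_dilation_parameters[OF U, of p z] s unfolding open_dist by blast
  have "p + sc (s + e / 2) (z - p) \<in> U"
    by (rule e) (use e(1) in \<open>simp add: dist_real_def\<close>)
  then show thesis
    using e(1) by (intro that[of "s + e / 2"]) (auto simp: dilate_def)
qed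

lemma mem_dilate_smaller:
  assumes U: "open U" and c: "0 < c" and z: "z \<in> dilate U p c"
  obtains d where "0 < d" "d < c" "z \<in> dilate U p d"
proof -
  obtain r where r: "1 / c < r" "z \<in> dilate U p (1 / r)"
    using mem_dilate_increase_parameter[OF U, of "1 / c"] c z by (auto simp: dilate_def)
  then have "r > 0" using c by (meson less_trans zero_less_divide_1_iff)
  then show thesis
    using r c by (intro that[of "1 / r"]) (auto simp: field_simps)
qed

lemma dilate_absorbing:
  assumes "open U" "p \<in> U"
  obtains c where "0 < c" "z \<in> dilate U p c"
proof -
  obtain r where "0 < r" "z \<in> dilate U p (1 / r)"
    using mem_dilate_increase_parameter[OF assms(1), of 0 p z] assms(2) by auto
  then show thesis using that[of "1 / r"] by simp
qed

text \<open>This is convexity of the gauge. In the convex combination of scaled points with weights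
  \<open>t i * c i / s\<close>, the factor \<open>c i\<close> cancels the scaling by
  \<open>1 / c i\<close>.\<close>

lemma dilate_combination:
  fixes l :: nat
  assumes U: "cvx U" and t: "\<And>i. i < l \<Longrightarrow> 0 < t i" "(\<Sum>i<l. t i) = 1"
    and c: "\<And>i. i < l \<Longrightarrow> 0 < c i" and z: "\<And>i. i < l \<Longrightarrow> z i \<in> dilate U p (c i)"
  shows "(\<Sum>i<l. sc (t i) (z i)) \<in> dilate U p (\<Sum>i<l. t i * c i)"
proof -
  define s where "s = (\<Sum>i<l. t i * c i)"
  have "l \<noteq> 0" using t(2) by (cases l) auto
  then have s: "s > 0"
    unfolding s_def using t c by (intro sum_pos) auto
  have "(\<Sum>i<l. sc (t i * c i / s) (p + sc (1 / c i) (z i - p))) \<in> U"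
  proof (rule cvx_sum[OF U])
    show "(\<Sum>i<l. t i * c i / s) = 1"
      using s by (simp add: s_def flip: sum_divide_distrib)
  qed (use t c z s in \<open>auto simp: dilate_def\<close>)
  also have "(\<Sum>i<l. sc (t i * c i / s) (p + sc (1 / c i) (z i - p))) =
      (\<Sum>i<l. sc (t i * c i / s) p + sc (t i / s) (z i - p))"
  proof (rule sum.cong)
    fix i assume "i \<in> {..<l}"
    then have "t i * c i / s * (1 / c i) = t i / s" using c[of i] by simp
    then show "sc (t i * c i / s) (p + sc (1 / c i) (z i - p)) = sc (t i * c i / s) p + sc (t i / s) (z i - p)"
      by (simp only: scale_right_distrib scale_scale)
  qed simp
  also have "\<dots> = sc (\<Sum>i<l. t i * c i / s) p + (\<Sum>i<l. sc (t i / s) (z i - p))"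
    by (simp add: sum.distrib scale_sum_left)
  also have "(\<Sum>i<l. t i * c i / s) = 1"
    using s by (simp add: s_def flip: sum_divide_distrib)
  also have "(\<Sum>i<l. sc (t i / s) (z i - p)) = sc (1 / s) (\<Sum>i<l. sc (t i) (z i) - sc (t i) p)"
    by (simp add: scale_sum_right scale_right_diff_distrib)
  also have "(\<Sum>i<l. sc (t i) (z i) - sc (t i) p) = (\<Sum>i<l. sc (t i) (z i)) - p"
    by (simp add: sum_subtractf t(2) flip: scale_sum_left)
  finally show ?thesis
    by (simp add: dilate_def s_def)
qed

text \<open>The dilations are nested, so the largest parameter of a finite subcover suffices. An
  empty subcover means that \<open>E\<close> is empty.\<close>

lemma compact_subset_dilate:
  assumes E: "compact E" and U: "open U" "cvx U" "p \<in> U"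
    and J: "J \<subseteq> {0<..}" "J \<noteq> {}" and cover: "E \<subseteq> (\<Union>c\<in>J. dilate U p c)"
  obtains c where "c \<in> J" "E \<subseteq> dilate U p c"
proof -
  obtain J' where J': "J' \<subseteq> J" "finite J'" "E \<subseteq> (\<Union>c\<in>J'. dilate U p c)"
    using compactE_image[OF E, of J "dilate U p"] open_dilate[OF U(1)] cover by metis
  show thesis
  proof (cases "J' = {}")
    case True
    then show thesis using J' J that by (metis UN_empty all_not_in_conv empty_subsetI subset_empty)
  next
    case False
    have "dilate U p c \<subseteq> dilate U p (Max J')" if "c \<in> J'" for c
      using that J' J False by (intro dilate_mono U Max_ge) auto
    then have "E \<subseteq> dilate U p (Max J')" using J'(3) by blast
    then show thesis using J' False by (intro that[of "Max J'"]) (auto dest: Max_in)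
  qed
qed

text \<open>The face where the gauge of \<open>U\<close> is maximal on \<open>E\<close> is again extremal. As only convexity of the
  gauge is used, no linear functionals and hence no Hahn--Banach theorem are needed.\<close>

lemma extremal_shrink:
  assumes E: "compact E" "extremal C E" and U: "open U" "cvx U" "p \<in> U" and nsub: "\<not> E \<subseteq> U"
  obtains E' where "compact E'" "E' \<noteq> {}" "extremal C E'" "E' \<subseteq> E" "E' \<inter> U = {}"
proof -
  \<comment> \<open>The infimum \<open>M\<close> of these parameters is the supremum of the gauge
    over \<open>E\<close>. It is at least 1 since the dilation with parameter 1 is \<open>U\<close>,
    which does not contain \<open>E\<close>.\<close>
  define S where "S = {c. 0 < c \<and> E \<subseteq> dilate U p c}"
  define M where "M = Inf S"
  have "E \<subseteq> (\<Union>c\<in>{0<..}. dilate U p c)"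
    using dilate_absorbing[OF U(1,3)] by (metis UN_I greaterThan_iff subsetI)
  then obtain c0 where "c0 \<in> {0<..}" "E \<subseteq> dilate U p c0"
    using compact_subset_dilate[OF E(1) U, of "{0<..}"] by auto
  then have S_ne: "S \<noteq> {}" by (auto simp: S_def)
  have S_ge: "1 \<le> c" if "c \<in> S" for c
  proof (rule ccontr)
    assume "\<not> 1 \<le> c"
    then have "dilate U p c \<subseteq> dilate U p 1"
      using that by (intro dilate_mono U) (auto simp: S_def)
    then show False using that nsub by (auto simp: S_def)
  qed
  have M1: "1 \<le> M"
    unfolding M_def by (rule cInf_greatest[OF S_ne S_ge])
  have bdd: "bdd_below S" by (rule bdd_belowI[of _ 1]) (rule S_ge)
  have above: "E \<subseteq> dilate U p c" if cM: "M < c" for c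
  proof -
    obtain s where "s \<in> S" "s < c" using cInf_lessD[OF S_ne, of c] cM unfolding M_def by blast
    then show ?thesis using dilate_mono[OF U(2,3), of s c] by (auto simp: S_def)
  qed
  have not_below: "\<not> E \<subseteq> dilate U p c" if "0 < c" "c < M" for c
  proof
    assume "E \<subseteq> dilate U p c"
    then have "c \<in> S" using that by (simp add: S_def)
    then have "M \<le> c" unfolding M_def by (rule cInf_lower[OF _ bdd])
    then show False using that by simp
  qed
  \<comment> \<open>On \<open>E\<close> the gauge is at most \<open>M\<close>, so removing the
    points with gauge less than \<open>M\<close> leaves those where it equals
    \<open>M\<close>.\<close>
  define E' where "E' = E - dilate U p M"
  have "compact E'"
    unfolding E'_def using E(1) open_dilate[OF U(1)] by (rule compact_diff)
  moreover have "E' \<noteq> {}"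
  proof
    assume "E' = {}"
    \<comment> \<open>If the supremum were not attained, the dilations with parameters below
      \<open>M\<close> would cover \<open>E\<close>, and by compactness a single one would contain
      it, against the choice of \<open>M\<close>.\<close>
    have "E \<subseteq> (\<Union>c\<in>{0<..<M}. dilate U p c)"
    proof
      fix z assume "z \<in> E"
      then have "z \<in> dilate U p M" using \<open>E' = {}\<close> by (auto simp: E'_def)
      then obtain d where "0 < d" "d < M" "z \<in> dilate U p d"
        using mem_dilate_smaller[OF U(1), of M z p] M1 by auto
      then show "z \<in> (\<Union>c\<in>{0<..<M}. dilate U p c)" by auto
    qed
    moreover have "{0<..<M} \<subseteq> {0<..}" "{0<..<M} \<noteq> {}" using M1 by auto
    ultimately obtain c where "c \<in> {0<..<M}" "E \<subseteq> dilate U p c"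
      using compact_subset_dilate[OF E(1) U, of "{0<..<M}"] by metis
    then show False using not_below by auto
  qed
  moreover have "extremal C E'"
    unfolding extremal_def
  proof (intro conjI allI impI)
    show "E' \<subseteq> C" using E(2) by (auto simp: E'_def extremal_def)
    fix l :: nat and t x j
    assume asm: "(\<forall>i<l. 0 < t i \<and> x i \<in> C) \<and> (\<Sum>i<l. t i) = 1 \<and> (\<Sum>i<l. sc (t i) (x i)) \<in> E'"
      and j: "j < l"
    then have "(\<Sum>i<l. sc (t i) (x i)) \<in> E" by (simp add: E'_def)
    then have xE: "x i \<in> E" if "i < l" for i
      using extremalD[OF E(2), of l t x] asm that by simp
    show "x j \<in> E'"
    proof (rule ccontr)
      assume "x j \<notin> E'"
      then have "x j \<in> dilate U p M" using xE[OF j] by (simp add: E'_def)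
      then obtain d where d: "0 < d" "d < M" "x j \<in> dilate U p d"
        using mem_dilate_smaller[OF U(1), of M "x j" p] M1 by auto
      \<comment> \<open>\<open>E\<close> is known to lie only in dilations with parameter above
        \<open>M\<close>, so the points other than \<open>x j\<close> get the parameter
        \<open>M + e\<close>. The gain at \<open>j\<close>, which is at least
        \<open>t j * (M - d) = 2 * e\<close>, outweighs this slack.\<close>
      define e where "e = t j * (M - d) / 2"
      have tj: "0 < t j" using asm j by auto
      have e: "0 < e" unfolding e_def using d tj by simp
      define c where "c = (\<lambda>i. if i = j then d else M + e)"
      have "(\<Sum>i<l. sc (t i) (x i)) \<in> dilate U p (\<Sum>i<l. t i * c i)"
      proof (rule dilate_combination[OF U(2)])
        show "x i \<in> dilate U p (c i)" if "i < l" for i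
          using d above[of "M + e"] e xE[OF that] by (auto simp: c_def)
      qed (use asm d e M1 in \<open>auto simp: c_def\<close>)
      moreover have "(\<Sum>i<l. t i * c i) \<le> M"
      proof -
        have "(\<Sum>i<l. t i * c i) = (\<Sum>i<l. t i * (M + e) - (if i = j then t j * (M + e - d) else 0))"
          by (intro sum.cong) (auto simp: c_def algebra_simps)
        also have "\<dots> = (M + e) - t j * (M + e - d)"
          using asm j by (simp add: sum_subtractf flip: sum_distrib_right)
        also have "\<dots> = M - e - t j * e" by (simp add: e_def field_simps)
        also have "\<dots> \<le> M" using e mult_pos_pos[OF tj e] by linarith
        finally show ?thesis .
      qed
      moreover have "0 < (\<Sum>i<l. t i * c i)"
        using asm j d e M1 by (intro sum_pos) (auto simp: c_def)
      ultimately have "(\<Sum>i<l. sc (t i) (x i)) \<in> dilate U p M"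
        using dilate_mono[OF U(2,3)] by blast
      then show False using asm by (simp add: E'_def)
    qed
  qed
  moreover have "E' \<inter> U = {}"
    using dilate_mono[OF U(2,3), of 1 M] M1 by (auto simp: E'_def)
  moreover have "E' \<subseteq> E" by (auto simp: E'_def)
  ultimately show thesis using that by blast
qed

lemma convex_nhd:
  assumes "open N" "p \<in> N"
  obtains W where "open W" "cvx W" "p \<in> W" "W \<subseteq> N"
proof -
  have "open ((\<lambda>w. w + p) -` N)"
    by (intro open_vimage assms continuous_intros)
  then obtain W0 where W0: "open W0" "0 \<in> W0" "W0 \<subseteq> (\<lambda>w. w + p) -` N" "cvx W0"
    using convex_base[of "(\<lambda>w. w + p) -` N"] assms(2) by (auto simp: cvx_def)
  define W where "W = (\<lambda>z. z - p) -` W0"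
  have "open W" unfolding W_def by (intro open_vimage W0(1) continuous_intros)
  moreover have "cvx W"
    unfolding cvx_def
  proof (intro ballI)
    fix x y t assume *: "x \<in> W" "y \<in> W" "t \<in> {0..1::real}"
    then have "sc t (x - p) + sc (1 - t) (y - p) \<in> W0"
      by (intro cvxD[OF W0(4)]) (auto simp: W_def)
    moreover have "sc t (x - p) + sc (1 - t) (y - p) = sc t x + sc (1 - t) y - p"
      by (simp add: scale_right_diff_distrib scale_left_diff_distrib)
    ultimately show "sc t x + sc (1 - t) y \<in> W" by (simp add: W_def)
  qed
  moreover have "p \<in> W" "W \<subseteq> N"
    using W0 by (auto simp: W_def)
  ultimately show thesis using that by blast
qed

lemma extremal_Inter:
  assumes "\<A> \<noteq> {}" and "\<And>E. E \<in> \<A> \<Longrightarrow> extremal C E"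
  shows "extremal C (\<Inter>\<A>)"
  unfolding extremal_def
proof (intro conjI allI impI InterI)
  show "\<Inter>\<A> \<subseteq> C" using assms by (auto simp: extremal_def)
  fix l :: nat and t x i E
  assume "(\<forall>i<l. 0 < t i \<and> x i \<in> C) \<and> (\<Sum>i<l. t i) = 1 \<and> (\<Sum>i<l. sc (t i) (x i)) \<in> \<Inter>\<A>"
    and "i < l" "E \<in> \<A>"
  then show "x i \<in> E"
    using extremalD[OF assms(2), of E l t x i] by simp
qed

text \<open>A minimal nonempty compact extremal subset is a single point: if it had two, a convex
  neighbourhood of one that misses the other would cut out a strictly smaller extremal
  subset.\<close>

lemma extremal_contains_point:
  assumes E: "compact E" "E \<noteq> {}" "extremal C E"
  obtains e where "e \<in> E" "extremal C {e}"
proof -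
  define F where "F = {X. compact X \<and> X \<noteq> {} \<and> extremal C X \<and> X \<subseteq> E}"
  \<comment> \<open>Zorn's lemma gives maximal sets, so it is applied to complements; unions of
    chains then correspond to intersections of compact extremal sets.\<close>
  have "\<exists>M\<in>uminus ` F. \<forall>X\<in>uminus ` F. M \<subseteq> X \<longrightarrow> X = M"
  proof (rule subset_Zorn_nonempty)
    show "uminus ` F \<noteq> {}" using E by (auto simp: F_def)
    fix \<C> assume \<C>: "\<C> \<noteq> {}" "subset.chain (uminus ` F) \<C>"
    define \<D> where "\<D> = uminus ` \<C>"
    have \<D>F: "\<D> \<subseteq> F"
      using \<C>(2) by (auto simp: \<D>_def subset_chain_def)
    have chain: "subset.chain F \<D>"
      using \<C>(2) by (auto simp: \<D>_def subset_chain_def)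
    have ne: "\<D> \<noteq> {}" using \<C> by (auto simp: \<D>_def)
    \<comment> \<open>Finite intersections within a chain are members of the chain, hence nonempty,
      so compactness of \<open>E\<close> applies.\<close>
    have "E \<inter> \<Inter>\<D> \<noteq> {}"
    proof (rule compact_imp_fip[OF E(1)])
      show "closed T" if "T \<in> \<D>" for T
        using that \<D>F by (auto simp: F_def intro: compact_imp_closed)
      fix \<B> assume \<B>: "finite \<B>" "\<B> \<subseteq> \<D>"
      show "E \<inter> \<Inter>\<B> \<noteq> {}"
      proof (cases "\<B> = {}")
        case True
        then show ?thesis using E by simp
      next
        case False
        have \<B>chain: "subset.chain F \<B>" using chain \<B> unfolding subset_chain_def by blast
        have "\<Inter>\<B> \<in> F" using Inter_in_chain[OF \<B>(1) False \<B>chain] \<B> \<D>F by blast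
        then show ?thesis unfolding F_def by blast
      qed
    qed
    moreover have "\<Inter>\<D> \<subseteq> E" using ne \<D>F by (auto simp: F_def)
    moreover have "compact (E \<inter> \<Inter>\<D>)"
      using \<D>F by (intro compact_Int_closed E(1) closed_Inter) (auto simp: F_def intro: compact_imp_closed)
    moreover have "E \<inter> \<Inter>\<D> = \<Inter>\<D>" using \<open>\<Inter>\<D> \<subseteq> E\<close> by blast
    moreover have "extremal C (\<Inter>\<D>)"
      using ne \<D>F by (intro extremal_Inter) (auto simp: F_def)
    ultimately have "\<Inter>\<D> \<in> F" by (auto simp: F_def)
    moreover have "\<Union>\<C> = - \<Inter>\<D>" by (auto simp: \<D>_def)
    ultimately show "\<Union>\<C> \<in> uminus ` F" by blast
  qed
  then obtain X where X: "X \<in> F" "\<And>Y. Y \<in> F \<Longrightarrow> Y \<subseteq> X \<Longrightarrow> Y = X"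
    by auto
  obtain e where e: "e \<in> X" using X(1) by (auto simp: F_def)
  have "y = e" if y: "y \<in> X" for y
  proof (rule ccontr)
    assume "y \<noteq> e"
    then obtain U where U: "open U" "cvx U" "e \<in> U" "U \<subseteq> - {y}"
      using convex_nhd[of "- {y}" e] by auto
    have "\<not> X \<subseteq> U" using y U by auto
    then obtain X' where X': "compact X'" "X' \<noteq> {}" "extremal C X'" "X' \<subseteq> X" "X' \<inter> U = {}"
      using X(1) extremal_shrink[OF _ _ U(1-3), of X C] by (auto simp: F_def)
    have "X \<subseteq> E" using X(1) by (simp add: F_def)
    then have "X' \<in> F" using X' by (simp add: F_def)
    then have "X' = X" using X'(4) by (rule X(2))
    then show False using X'(5) e U(3) by auto
  qed
  then have "X = {e}" using e by blast
  then have "e \<in> E" "extremal C {e}" using X(1) by (auto simp: F_def)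
  then show thesis by (rule that)
qed

text \<open>A point of \<open>C\<close> outside the closure of \<open>D\<close> is outside an open
  convex set \<open>U = D + W\<close>. The part of \<open>C\<close> where the gauge of
  \<open>U\<close> is maximal avoids \<open>U\<close>, yet it contains an extreme point, which would
  have to lie in \<open>D\<close>.\<close>

theorem compact_subset_closure_convex:
  assumes C: "compact C" and D: "cvx D" and ext: "\<And>e. extremal C {e} \<Longrightarrow> e \<in> D"
  shows "C \<subseteq> closure D"
proof
  fix x assume x: "x \<in> C"
  have CC: "extremal C C" by (auto simp: extremal_def)
  \<comment> \<open>The gauge needs a centre in \<open>U\<close>. A nonempty \<open>C\<close> has an
    extreme point, so \<open>D\<close> is nonempty.\<close>
  obtain d0 where d0: "d0 \<in> D"
    using extremal_contains_point[OF C _ CC] x ext by (metis empty_iff)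
  show "x \<in> closure D"
  proof (rule ccontr)
    assume nx: "x \<notin> closure D"
    \<comment> \<open>With \<open>x - w\<close> instead of \<open>x + w\<close> the neighbourhood
      need not be symmetric: if \<open>x - d\<close> is in \<open>W\<close>, then
      \<open>d = x - (x - d)\<close> would be outside the closure of \<open>D\<close>.\<close>
    have "open ((\<lambda>w. x - w) -` (- closure D))"
      by (intro open_vimage continuous_intros) auto
    then obtain W where W: "open W" "cvx W" "0 \<in> W" "W \<subseteq> (\<lambda>w. x - w) -` (- closure D)"
      using convex_nhd[of "(\<lambda>w. x - w) -` (- closure D)" 0] nx by auto
    define U where "U = (\<Union>d\<in>D. (\<lambda>z. z - d) -` W)"
    have "open U"
      unfolding U_def by (intro open_UN ballI open_vimage W(1) continuous_intros)
    moreover have "cvx U"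
      unfolding cvx_def
    proof (intro ballI)
      fix a b t assume *: "a \<in> U" "b \<in> U" "t \<in> {0..1::real}"
      then obtain d d' where d: "d \<in> D" "d' \<in> D" "a - d \<in> W" "b - d' \<in> W" by (auto simp: U_def)
      have "sc t (a - d) + sc (1 - t) (b - d') \<in> W"
        using d * by (intro cvxD[OF W(2)]) auto
      moreover have "sc t (a - d) + sc (1 - t) (b - d') = sc t a + sc (1 - t) b - (sc t d + sc (1 - t) d')"
        by (simp add: scale_right_diff_distrib)
      moreover have "sc t d + sc (1 - t) d' \<in> D"
        using d * by (intro cvxD[OF D]) auto
      ultimately show "sc t a + sc (1 - t) b \<in> U" by (auto simp: U_def)
    qed
    moreover have DU: "D \<subseteq> U" using W(3) by (force simp: U_def)
    moreover have "x \<notin> U"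
    proof
      assume "x \<in> U"
      then obtain d where "d \<in> D" "x - d \<in> W" by (auto simp: U_def)
      then have "x - (x - d) \<notin> closure D" using W(4) by auto
      then show False using \<open>d \<in> D\<close> closure_subset[of D] by auto
    qed
    moreover have "d0 \<in> U" "\<not> C \<subseteq> U" using DU d0 x \<open>x \<notin> U\<close> by auto
    ultimately obtain E' where E': "compact E'" "E' \<noteq> {}" "extremal C E'" "E' \<inter> U = {}"
      using extremal_shrink[OF C CC, of U d0] by metis
    obtain e where "e \<in> E'" "extremal C {e}"
      by (rule extremal_contains_point[OF E'(1-3)])
    then show False using ext[of e] E'(4) DU by auto
  qed
qed

end

subsection \<open>Examples of locally convex spaces\<close>

lemma real_lctvs_prod:
  assumes "real_lctvs sc1" "real_lctvs sc2"
  shows "real_lctvs (\<lambda>r p. (sc1 r (fst p), sc2 r (snd p)))"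
proof -
  interpret A: real_lctvs sc1 by fact
  interpret B: real_lctvs sc2 by fact
  let ?sc = "\<lambda>r p. (sc1 r (fst p), sc2 r (snd p))"
  show ?thesis
  proof
    show "continuous_on S (?sc a)" for S a
      by (intro continuous_on_Pair
          continuous_on_compose2[OF A.continuous_on_scale_vector[of UNIV] continuous_on_fst[OF continuous_on_id] subset_UNIV]
          continuous_on_compose2[OF B.continuous_on_scale_vector[of UNIV] continuous_on_snd[OF continuous_on_id] subset_UNIV])
    show "continuous_on T (\<lambda>a. ?sc a x)" for T x
      by (intro continuous_on_Pair A.continuous_on_scale_scalar B.continuous_on_scale_scalar)
    fix U :: "('a \<times> 'b) set" assume "open U" "0 \<in> U"
    then obtain U1 U2 where U: "open U1" "open U2" "0 \<in> U1" "0 \<in> U2" "U1 \<times> U2 \<subseteq> U"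
      by (auto simp: zero_prod_def elim!: open_prod_elim)
    obtain W1 where W1: "open W1" "A.cvx W1" "0 \<in> W1" "W1 \<subseteq> U1"
      using A.convex_nhd[OF U(1,3)] .
    obtain W2 where W2: "open W2" "B.cvx W2" "0 \<in> W2" "W2 \<subseteq> U2"
      using B.convex_nhd[OF U(2,4)] .
    show "\<exists>W. open W \<and> 0 \<in> W \<and> W \<subseteq> U \<and>
        (\<forall>x\<in>W. \<forall>y\<in>W. \<forall>t\<in>{0..1}. ?sc t x + ?sc (1 - t) y \<in> W)"
      using W1 W2 U by (intro exI[of _ "W1 \<times> W2"])
        (auto simp: zero_prod_def open_Times A.cvx_def B.cvx_def)
  qed (auto simp: A.scale_right_distrib A.scale_left_distrib B.scale_right_distrib B.scale_left_distrib)
qed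

lemma real_lctvs_fun:
  assumes "real_lctvs sc"
  shows "real_lctvs (\<lambda>r f i. sc r (f i))"
proof -
  interpret A: real_lctvs sc by fact
  let ?sc = "\<lambda>r f i. sc r (f i)"
  show ?thesis
  proof
    show "continuous_on S (?sc a)" for S a
      by (rule continuous_on_coordinatewise_then_product)
        (rule continuous_on_compose2[OF A.continuous_on_scale_vector continuous_on_product_then_coordinatewise[OF continuous_on_id] subset_UNIV])
    show "continuous_on T (\<lambda>a. ?sc a x)" for T x
      by (rule continuous_on_coordinatewise_then_product) (rule A.continuous_on_scale_scalar)
    fix U :: "('b \<Rightarrow> 'a) set" assume U: "open U" "0 \<in> U"
    then obtain X where X: "0 \<in> Pi\<^sub>E UNIV X" "\<And>i. open (X i)" "finite {i. X i \<noteq> UNIV}" "Pi\<^sub>E UNIV X \<subseteq> U"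
      using product_topology_open_contains_basis[of "\<lambda>_. euclidean" UNIV U 0]
      by (auto simp: open_fun_def)
    \<comment> \<open>Factors equal to \<open>UNIV\<close> must stay so, in order that the product
      of the smaller factors is again open.\<close>
    have "\<exists>W. open W \<and> A.cvx W \<and> 0 \<in> W \<and> W \<subseteq> X i \<and> (X i = UNIV \<longrightarrow> W = UNIV)" for i
    proof (cases "X i = UNIV")
      case True
      then show ?thesis by (intro exI[of _ UNIV]) (auto simp: A.cvx_def)
    next
      case False
      have "0 \<in> X i" using X(1) by (auto simp: PiE_iff)
      then show ?thesis using A.convex_nhd[OF X(2)] False by metis
    qed
    then obtain W where W: "\<And>i. open (W i)" "\<And>i. A.cvx (W i)" "\<And>i. 0 \<in> W i" "\<And>i. W i \<subseteq> X i"
      "\<And>i. X i = UNIV \<Longrightarrow> W i = UNIV"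
      by metis
    have "{i. W i \<noteq> UNIV} \<subseteq> {i. X i \<noteq> UNIV}" using W(5) by auto
    then have "open (Pi\<^sub>E UNIV W)"
      using W(1) X(3) by (intro open_PiE) (auto intro: finite_subset)
    moreover have "Pi\<^sub>E UNIV W \<subseteq> U" using W(4) X(4) by (fastforce simp: PiE_iff)
    ultimately show "\<exists>W. open W \<and> 0 \<in> W \<and> W \<subseteq> U \<and>
        (\<forall>x\<in>W. \<forall>y\<in>W. \<forall>t\<in>{0..1}. ?sc t x + ?sc (1 - t) y \<in> W)"
      using W(2,3) by (intro exI[of _ "Pi\<^sub>E UNIV W"]) (auto simp: A.cvx_def PiE_iff)
  qed (auto simp: fun_eq_iff A.scale_right_distrib A.scale_left_distrib)
qed

lemma real_lctvs_scaleR: "real_lctvs (scaleR :: real \<Rightarrow> 'a::real_normed_vector \<Rightarrow> 'a)"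
proof
  fix U :: "'a set" assume "open U" "0 \<in> U"
  then obtain e where e: "e > 0" "\<And>x. norm x < e \<Longrightarrow> x \<in> U"
    unfolding open_dist by (metis dist_0_norm dist_commute)
  have "norm (t *\<^sub>R x + (1 - t) *\<^sub>R y) < e"
    if "norm x < e" "norm y < e" "0 \<le> t" "t \<le> 1" for x y :: 'a and t :: real
  proof -
    have "norm (t *\<^sub>R x + (1 - t) *\<^sub>R y) \<le> t * norm x + (1 - t) * norm y"
      using norm_triangle_ineq[of "t *\<^sub>R x" "(1 - t) *\<^sub>R y"] that by simp
    also have "\<dots> < e" using that by (intro convex_bound_lt) auto
    finally show ?thesis .
  qed
  moreover have "open {x::'a. norm x < e}"
    by (intro open_Collect_less continuous_intros)
  ultimately show "\<exists>W. open W \<and> 0 \<in> W \<and> W \<subseteq> U \<and>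
      (\<forall>x\<in>W. \<forall>y\<in>W. \<forall>t\<in>{0..1}. t *\<^sub>R x + (1 - t) *\<^sub>R y \<in> W)"
    using e by (intro exI[of _ "{x. norm x < e}"]) auto
qed (auto intro!: continuous_intros simp: algebra_simps)

lemma (in locally_convex_tvs) continuous_on_smul:
  assumes "continuous_on S f" "continuous_on S g"
  shows "continuous_on S (\<lambda>x. smul (f x) (g x))"
  using continuous_on_compose2[OF continuous_scale continuous_on_Pair[OF assms] subset_UNIV] by simp

lemma (in locally_convex_tvs) real_lctvs_smul: "real_lctvs (\<lambda>r. smul (of_real r))"
proof
  show "continuous_on S (smul (of_real a))" for S a
    by (intro continuous_on_smul continuous_intros)
  show "continuous_on T (\<lambda>a. smul (of_real a) x)" for T x
    by (intro continuous_on_smul continuous_intros)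
qed (use locally_convex in \<open>auto simp: scale_right_distrib scale_left_distrib\<close>)

subsection \<open>Complex matrices\<close>

lemma carrier_mat_adjoint [simp]:
  "A \<in> carrier_mat n m \<Longrightarrow> mat_adjoint A \<in> carrier_mat m n"
  by (auto simp: mat_adjoint_def mat_of_rows_def)

lemma dim_mat_adjoint [simp]:
  "dim_row (mat_adjoint A) = dim_col A" "dim_col (mat_adjoint A) = dim_row A"
  by (auto simp: mat_adjoint_def mat_of_rows_def)

lemma index_mat_adjoint [simp]:
  "i < dim_col A \<Longrightarrow> j < dim_row A \<Longrightarrow> mat_adjoint A $$ (i, j) = conjugate (A $$ (j, i))"
  by (simp add: mat_adjoint_def mat_of_rows_index)

lemma index_mult_mat_sum:
  "i < dim_row A \<Longrightarrow> j < dim_col B \<Longrightarrow> dim_col A = dim_row B \<Longrightarrow>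
    (A * B) $$ (i, j) = (\<Sum>k<dim_row B. A $$ (i, k) * B $$ (k, j))"
  by (simp add: scalar_prod_def lessThan_atLeast0)

lemma mat_adjoint_adjoint [simp]: "mat_adjoint (mat_adjoint (A :: complex mat)) = A"
  by (intro eq_matI) auto

lemma mat_adjoint_one [simp]: "mat_adjoint (1\<^sub>m n :: complex mat) = 1\<^sub>m n"
  by (intro eq_matI) auto

lemma index_gram_mat:
  fixes A :: "complex mat"
  assumes "i < dim_col A" "j < dim_col A"
  shows "(mat_adjoint A * A) $$ (i, j) = (\<Sum>p<dim_row A. cnj (A $$ (p, i)) * A $$ (p, j))"
  using assms by (simp add: index_mult_mat_sum del: index_mult_mat(1))

text \<open>Gram-Schmidt, one column of \<open>a\<close> per induction step: \<open>q\<close> has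
  orthonormal columns, \<open>c\<close> holds the coordinates of the columns of \<open>a\<close>,
  and \<open>b\<close> is a right inverse of \<open>c\<close>. Functions are used since both sizes
  may grow from step to step.\<close>

lemma qr_functions:
  fixes a :: "nat \<Rightarrow> nat \<Rightarrow> complex"
  shows "\<exists>(r::nat) (q::nat \<Rightarrow> nat \<Rightarrow> complex) (c::nat \<Rightarrow> nat \<Rightarrow> complex) (b::nat \<Rightarrow> nat \<Rightarrow> complex).
    (\<forall>i<r. \<forall>j<r. (\<Sum>p<n. cnj (q p i) * q p j) = (if i = j then 1 else 0)) \<and>
    (\<forall>i<n. \<forall>j<k. a i j = (\<Sum>l<r. q i l * c l j)) \<and>
    (\<forall>i<r. \<forall>j<r. (\<Sum>l<k. c i l * b l j) = (if i = j then 1 else 0))"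
proof (induction k)
  case 0
  show ?case by (intro exI[of _ "0::nat"]) auto
next
  case (Suc k)
  from Suc.IH obtain r :: nat and q c b where H:
    "(\<forall>i<r. \<forall>j<r. (\<Sum>p<n. cnj (q p i) * q p j) = (if i = j then 1 else 0)) \<and>
    (\<forall>i<n. \<forall>j<k. a i j = (\<Sum>l<r. q i l * c l j)) \<and>
    (\<forall>i<r. \<forall>j<r. (\<Sum>l<k. c i l * b l j) = (if i = j then 1 else 0))"
    by (elim exE) (rule that)
  have q: "(\<Sum>p<n. cnj (q p i) * q p j) = (if i = j then 1 else 0)" if "i < r" "j < r" for i j
    using H that by blast
  have a: "a i j = (\<Sum>l<r. q i l * c l j)" if "i < n" "j < k" for i j
    using H that by blast
  have b: "(\<Sum>l<k. c i l * b l j) = (if i = j then 1 else 0)" if "i < r" "j < r" for i j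
    using H that by blast
  \<comment> \<open>\<open>y\<close> contains the coordinates of the new column along the old
    orthonormal columns, \<open>z\<close> is the residual, and \<open>N\<close> its squared
    norm.\<close>
  define y where "y = (\<lambda>i. \<Sum>p<n. cnj (q p i) * a p k)"
  define z where "z = (\<lambda>p. a p k - (\<Sum>l<r. q p l * y l))"
  define N where "N = (\<Sum>p<n. (cmod (z p))\<^sup>2)"
  have qz: "(\<Sum>p<n. cnj (q p i) * z p) = 0" if i: "i < r" for i
  proof -
    have "(\<Sum>p<n. cnj (q p i) * (\<Sum>l<r. q p l * y l)) = (\<Sum>p<n. \<Sum>l<r. cnj (q p i) * q p l * y l)"
      by (simp add: sum_distrib_left mult.assoc)
    also have "\<dots> = (\<Sum>l<r. (\<Sum>p<n. cnj (q p i) * q p l) * y l)"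
      by (subst sum.swap) (simp add: sum_distrib_right)
    also have "\<dots> = (\<Sum>l<r. if i = l then y l else 0)"
      using q i by (intro sum.cong) auto
    also have "\<dots> = y i" using i by simp
    finally show ?thesis by (simp add: z_def right_diff_distrib sum_subtractf y_def)
  qed
  show ?case
  proof (cases "N = 0")
    case True
    then have "\<forall>p\<in>{..<n}. (cmod (z p))\<^sup>2 = 0"
      unfolding N_def by (subst (asm) sum_nonneg_eq_0_iff) auto
    then have z0: "a p k = (\<Sum>l<r. q p l * y l)" if "p < n" for p
      using that by (simp add: z_def)
    \<comment> \<open>The new column depends on the old ones: \<open>c\<close> gains the column
      \<open>y\<close>, and a zero row in \<open>b\<close> keeps the product unchanged.\<close>
    define c' where "c' = (\<lambda>i l. if l < k then c i l else y i)"
    define b' where "b' = (\<lambda>l j. if l < k then b l j else 0)"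
    have "a i j = (\<Sum>l<r. q i l * c' l j)" if "i < n" "j < Suc k" for i j
      using that a[of i j] z0[of i] by (cases "j = k") (auto simp: c'_def)
    moreover have "(\<Sum>l<Suc k. c' i l * b' l j) = (if i = j then 1 else 0)" if "i < r" "j < r" for i j
      using b[OF that] by (simp add: c'_def b'_def)
    ultimately show ?thesis using q by blast
  next
    case False
    define \<nu> where "\<nu> = complex_of_real (sqrt N)"
    have "N \<ge> 0" unfolding N_def by (intro sum_nonneg) auto
    then have \<nu>: "\<nu> \<noteq> 0" "\<nu> * \<nu> = of_real N" "cnj \<nu> = \<nu>"
      using False by (auto simp: \<nu>_def simp flip: of_real_mult)
    define q' where "q' = (\<lambda>p i. if i < r then q p i else z p / \<nu>)"
    \<comment> \<open>The new coefficients form the block matrix with rows (\<open>c\<close>,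
      \<open>y\<close>) and (0, \<nu>). Its right inverse has rows (\<open>b\<close>, -
      \<open>b y\<close> / \<nu>) and (0, 1 / \<nu>), as in the inversion of block triangular
      matrices.\<close>
    define c' where "c' = (\<lambda>i l. if i < r then (if l < k then c i l else y i) else (if l < k then 0 else \<nu>))"
    define b' where "b' = (\<lambda>l j. if l < k then (if j < r then b l j else - (\<Sum>m<r. b l m * y m) / \<nu>)
      else (if j < r then 0 else 1 / \<nu>))"
    have zz: "(\<Sum>p<n. cnj (z p / \<nu>) * (z p / \<nu>)) = 1"
    proof -
      have "(\<Sum>p<n. cnj (z p / \<nu>) * (z p / \<nu>)) = (\<Sum>p<n. of_real ((cmod (z p))\<^sup>2) / (\<nu> * \<nu>))"
        by (intro sum.cong refl) (simp add: \<nu>(3) mult.commute complex_norm_square[of "z _", symmetric] flip: of_real_power)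
      also have "\<dots> = of_real N / (\<nu> * \<nu>)"
        by (simp add: N_def sum_divide_distrib)
      finally show ?thesis using False \<nu> by simp
    qed
    have qz': "(\<Sum>p<n. cnj (q p i) * (z p / \<nu>)) = 0" if "i < r" for i
      using qz[OF that] by (simp flip: sum_divide_distrib)
    have zq': "(\<Sum>p<n. cnj (z p / \<nu>) * q p i) = 0" if "i < r" for i
    proof -
      have "(\<Sum>p<n. cnj (z p / \<nu>) * q p i) = cnj (\<Sum>p<n. cnj (q p i) * (z p / \<nu>))"
        by (simp add: mult.commute)
      also have "\<dots> = 0" by (simp only: qz'[OF that] complex_cnj_zero)
      finally show ?thesis .
    qed
    have 1: "(\<Sum>p<n. cnj (q' p i) * q' p j) = (if i = j then 1 else 0)" if ij: "i < Suc r" "j < Suc r" for i j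
    proof -
      consider "i < r" "j < r" | "i < r" "j = r" | "i = r" "j < r" | "i = r" "j = r"
        using ij by linarith
      then show ?thesis
        using q[of i j] qz'[of i] zq'[of j] zz by cases (simp_all add: q'_def)
    qed
    have 2: "a i j = (\<Sum>l<Suc r. q' i l * c' l j)" if "i < n" "j < Suc k" for i j
    proof (cases "j < k")
      case True
      then show ?thesis using a[of i j] that by (simp add: q'_def c'_def)
    next
      case False
      then have "j = k" using that by simp
      then show ?thesis using \<nu>(1) by (simp add: q'_def c'_def z_def)
    qed
    have 3: "(\<Sum>l<Suc k. c' i l * b' l j) = (if i = j then 1 else 0)"
      if ij: "i < Suc r" "j < Suc r" for i j
    proof (cases "i < r \<and> j = r")
      case True
      have "(\<Sum>l<k. c i l * (\<Sum>m<r. b l m * y m)) = (\<Sum>l<k. \<Sum>m<r. c i l * b l m * y m)"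
        by (simp add: sum_distrib_left mult.assoc)
      also have "\<dots> = (\<Sum>m<r. (\<Sum>l<k. c i l * b l m) * y m)"
        by (subst sum.swap) (simp add: sum_distrib_right)
      also have "\<dots> = (\<Sum>m<r. if i = m then y m else 0)"
        using b True by (intro sum.cong) auto
      finally have "(\<Sum>l<k. c i l * (\<Sum>m<r. b l m * y m)) = y i"
        using True by simp
      then have "(\<Sum>l<k. c i l * (- (\<Sum>m<r. b l m * y m) / \<nu>)) = - y i / \<nu>"
        by (simp add: sum_negf flip: sum_divide_distrib)
      then show ?thesis using True by (simp add: c'_def b'_def)
    next
      case False
      then consider "i < r" "j < r" | "i = r" "j < r" | "i = r" "j = r"
        using ij by linarith
      then show ?thesis using b[of i j] \<nu>(1) by cases (simp_all add: c'_def b'_def)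
    qed
    show ?thesis
      by (intro exI[of _ "Suc r"] exI[of _ q'] exI[of _ c'] exI[of _ b'] conjI allI impI 1 2 3)
  qed
qed

text \<open>The isometry can be absorbed into the matrix taken from a convex collection, which
  leaves a right invertible coefficient. The assumption that \<open>A\<close> is nonzero makes the
  inner size positive.\<close>

lemma isometry_factorization:
  fixes A :: "complex mat"
  assumes A: "A \<in> carrier_mat n k" and A0: "A \<noteq> 0\<^sub>m n k"
  obtains r Q C where "0 < r" "Q \<in> carrier_mat n r" "C \<in> carrier_mat r k"
    "mat_adjoint Q * Q = 1\<^sub>m r" "A = Q * C" "right_invertible_mat C"
proof -
  obtain r :: nat and q c b where H:
    "(\<forall>i<r. \<forall>j<r. (\<Sum>p<n. cnj (q p i) * q p j) = (if i = j then 1 else 0)) \<and>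
    (\<forall>i<n. \<forall>j<k. A $$ (i, j) = (\<Sum>l<r. q i l * c l j)) \<and>
    (\<forall>i<r. \<forall>j<r. (\<Sum>l<k. c i l * b l j) = (if i = j then 1 else 0))"
    using qr_functions[of n k "\<lambda>i j. A $$ (i, j)"] by (elim exE) (rule that)
  have q: "(\<Sum>p<n. cnj (q p i) * q p j) = (if i = j then 1 else 0)" if "i < r" "j < r" for i j
    using H that by blast
  have a: "A $$ (i, j) = (\<Sum>l<r. q i l * c l j)" if "i < n" "j < k" for i j
    using H that by blast
  have b: "(\<Sum>l<k. c i l * b l j) = (if i = j then 1 else 0)" if "i < r" "j < r" for i j
    using H that by blast
  define Q where "Q = mat n r (\<lambda>(i, j). q i j)"
  define C where "C = mat r k (\<lambda>(i, j). c i j)"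
  define B where "B = mat k r (\<lambda>(i, j). b i j)"
  have car: "Q \<in> carrier_mat n r" "C \<in> carrier_mat r k" "B \<in> carrier_mat k r"
    by (auto simp: Q_def C_def B_def)
  have "mat_adjoint Q * Q = 1\<^sub>m r"
    using q by (intro eq_matI) (auto simp: index_gram_mat Q_def simp del: index_mult_mat(1))
  moreover have "A = Q * C"
    using a A by (intro eq_matI) (auto simp: index_mult_mat_sum Q_def C_def simp del: index_mult_mat(1))
  moreover have "C * B = 1\<^sub>m r"
    using b by (intro eq_matI) (auto simp: index_mult_mat_sum B_def C_def simp del: index_mult_mat(1))
  then have "right_invertible_mat C"
    unfolding right_invertible_mat_def inverts_mat_def using car by auto
  moreover have "0 < r"
  proof (rule ccontr)
    assume "\<not> 0 < r"
    then have "A = 0\<^sub>m n k" using a A by (intro eq_matI) auto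
    then show False using A0 by simp
  qed
  ultimately show thesis using that car by blast
qed

text \<open>If \<open>n < r\<close>, padding with zeros gives square matrices with the same product.
  A right inverse of a square matrix is also a left inverse, but row \<open>n\<close> of the padded
  \<open>B\<close> vanishes.\<close>

lemma right_inverse_dim_le:
  fixes A B :: "'a::field mat"
  assumes A: "A \<in> carrier_mat r n" and B: "B \<in> carrier_mat n r" and AB: "A * B = 1\<^sub>m r"
  shows "r \<le> n"
proof (rule ccontr)
  assume "\<not> r \<le> n"
  then have nr: "n < r" by simp
  define A' where "A' = mat r r (\<lambda>(i, j). if j < n then A $$ (i, j) else 0)"
  define B' where "B' = mat r r (\<lambda>(i, j). if i < n then B $$ (i, j) else 0)"
  have car: "A' \<in> carrier_mat r r" "B' \<in> carrier_mat r r"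
    by (auto simp: A'_def B'_def)
  have "A' * B' = A * B"
  proof (rule eq_matI)
    fix i j assume "i < dim_row (A * B)" "j < dim_col (A * B)"
    then have ij: "i < r" "j < r" using A B by auto
    have "(A' * B') $$ (i, j) = (\<Sum>k<r. A' $$ (i, k) * B' $$ (k, j))"
      using ij car by (subst index_mult_mat_sum) auto
    also have "\<dots> = (\<Sum>k<n. A' $$ (i, k) * B' $$ (k, j))"
      using nr ij by (intro sum.mono_neutral_right) (auto simp: A'_def)
    also have "\<dots> = (\<Sum>k<n. A $$ (i, k) * B $$ (k, j))"
      using nr ij by (intro sum.cong) (auto simp: A'_def B'_def)
    also have "\<dots> = (A * B) $$ (i, j)"
      using ij A B by (subst index_mult_mat_sum) auto
    finally show "(A' * B') $$ (i, j) = (A * B) $$ (i, j)" .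
  qed (use A B car in auto)
  then have "B' * A' = 1\<^sub>m r"
    using AB mat_mult_left_right_inverse[OF car] by simp
  then have "(B' * A') $$ (n, n) = 1" using nr by simp
  moreover have "(B' * A') $$ (n, n) = (\<Sum>k<r. B' $$ (n, k) * A' $$ (k, n))"
    using nr car by (subst index_mult_mat_sum) auto
  moreover have "\<dots> = 0" using nr by (intro sum.neutral) (auto simp: B'_def)
  ultimately show False by simp
qed

lemma right_invertible_mat_dim_le:
  "right_invertible_mat A \<Longrightarrow> dim_row A \<le> dim_col A"
  unfolding right_invertible_mat_def inverts_mat_def
  by (metis carrier_matI right_inverse_dim_le)

subsection \<open>Compressions\<close>

lemma compress_carrier [simp]:
  "\<alpha> \<in> carrier_mat r n \<Longrightarrow> \<beta> \<in> carrier_mat s m \<Longrightarrow> compress smul \<alpha> v \<beta> \<in> carrier_mat n m"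
  by (auto simp: compress_def)

lemma dim_compress [simp]:
  "dim_row (compress smul \<alpha> v \<beta>) = dim_col \<alpha>" "dim_col (compress smul \<alpha> v \<beta>) = dim_col \<beta>"
  by (auto simp: compress_def)

lemma index_compress:
  assumes "\<alpha> \<in> carrier_mat r n" "v \<in> carrier_mat r s" "\<beta> \<in> carrier_mat s m" "i < n" "j < m"
  shows "compress smul \<alpha> v \<beta> $$ (i, j) =
    (\<Sum>p<r. \<Sum>q<s. smul (cnj (\<alpha> $$ (p, i)) * \<beta> $$ (q, j)) (v $$ (p, q)))"
  using assms by (simp add: compress_def)

lemma (in vector_space) scale_sum_mult:
  "scale (sum f A * sum g B) x = (\<Sum>a\<in>A. \<Sum>b\<in>B. scale (f a * g b) x)"
  by (simp add: sum_product scale_sum_left)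

lemma sum_swap_pairs:
  "(\<Sum>p\<in>A. \<Sum>q\<in>B. \<Sum>p'\<in>C. \<Sum>q'\<in>D. f p q p' q') =
    (\<Sum>p'\<in>C. \<Sum>q'\<in>D. \<Sum>p\<in>A. \<Sum>q\<in>B. f p q p' q')"
proof -
  have "(\<Sum>p\<in>A. \<Sum>q\<in>B. \<Sum>p'\<in>C. \<Sum>q'\<in>D. f p q p' q') = (\<Sum>p\<in>A. \<Sum>p'\<in>C. \<Sum>q\<in>B. \<Sum>q'\<in>D. f p q p' q')"
    by (intro sum.cong refl sum.swap)
  also have "\<dots> = (\<Sum>p'\<in>C. \<Sum>p\<in>A. \<Sum>q\<in>B. \<Sum>q'\<in>D. f p q p' q')"
    by (rule sum.swap)
  also have "\<dots> = (\<Sum>p'\<in>C. \<Sum>p\<in>A. \<Sum>q'\<in>D. \<Sum>q\<in>B. f p q p' q')"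
    by (intro sum.cong refl sum.swap)
  also have "\<dots> = (\<Sum>p'\<in>C. \<Sum>q'\<in>D. \<Sum>p\<in>A. \<Sum>q\<in>B. f p q p' q')"
    by (intro sum.cong refl sum.swap)
  finally show ?thesis .
qed

lemma compress_compress:
  fixes smul :: "complex \<Rightarrow> 'v::ab_group_add \<Rightarrow> 'v"
  assumes vs: "vector_space smul"
    and c: "\<gamma> \<in> carrier_mat r' r" "v \<in> carrier_mat r' s'" "\<delta> \<in> carrier_mat s' s"
      "\<alpha> \<in> carrier_mat r n" "\<beta> \<in> carrier_mat s m"
  shows "compress smul \<alpha> (compress smul \<gamma> v \<delta>) \<beta> = compress smul (\<gamma> * \<alpha>) v (\<delta> * \<beta>)"
proof (rule eq_matI)
  interpret vector_space smul by fact
  fix i j assume "i < dim_row (compress smul (\<gamma> * \<alpha>) v (\<delta> * \<beta>))"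
    and "j < dim_col (compress smul (\<gamma> * \<alpha>) v (\<delta> * \<beta>))"
  then have ij: "i < n" "j < m" using c by auto
  let ?T = "\<lambda>p q p' q'. smul (cnj (\<alpha> $$ (p, i)) * cnj (\<gamma> $$ (p', p)) * (\<delta> $$ (q', q) * \<beta> $$ (q, j))) (v $$ (p', q'))"
  have "compress smul \<alpha> (compress smul \<gamma> v \<delta>) \<beta> $$ (i, j) =
      (\<Sum>p<r. \<Sum>q<s. smul (cnj (\<alpha> $$ (p, i)) * \<beta> $$ (q, j)) (compress smul \<gamma> v \<delta> $$ (p, q)))"
    using c ij by (intro index_compress) auto
  also have "\<dots> = (\<Sum>p<r. \<Sum>q<s. smul (cnj (\<alpha> $$ (p, i)) * \<beta> $$ (q, j))
      (\<Sum>p'<r'. \<Sum>q'<s'. smul (cnj (\<gamma> $$ (p', p)) * \<delta> $$ (q', q)) (v $$ (p', q'))))"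
    using c by (intro sum.cong refl arg_cong[where f = "smul _"] index_compress) auto
  also have "\<dots> = (\<Sum>p<r. \<Sum>q<s. \<Sum>p'<r'. \<Sum>q'<s'. ?T p q p' q')"
    by (simp add: scale_sum_right mult_ac)
  also have "\<dots> = (\<Sum>p'<r'. \<Sum>q'<s'. \<Sum>p<r. \<Sum>q<s. ?T p q p' q')"
    by (rule sum_swap_pairs)
  also have "\<dots> = (\<Sum>p'<r'. \<Sum>q'<s'. smul ((\<Sum>p<r. cnj (\<alpha> $$ (p, i)) * cnj (\<gamma> $$ (p', p))) *
      (\<Sum>q<s. \<delta> $$ (q', q) * \<beta> $$ (q, j))) (v $$ (p', q')))"
    by (simp only: scale_sum_mult)
  also have "\<dots> = (\<Sum>p'<r'. \<Sum>q'<s'. smul (cnj ((\<gamma> * \<alpha>) $$ (p', i)) * (\<delta> * \<beta>) $$ (q', j)) (v $$ (p', q')))"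
    using c ij
    by (intro sum.cong refl) (auto simp: index_mult_mat_sum mult.commute simp del: index_mult_mat(1))
  also have "\<dots> = compress smul (\<gamma> * \<alpha>) v (\<delta> * \<beta>) $$ (i, j)"
    using c ij by (intro index_compress[symmetric]) auto
  finally show "compress smul \<alpha> (compress smul \<gamma> v \<delta>) \<beta> $$ (i, j) = compress smul (\<gamma> * \<alpha>) v (\<delta> * \<beta>) $$ (i, j)" .
qed (use c in auto)

lemma mat_sum_carrier [simp]: "mat_sum n m l A \<in> carrier_mat n m"
  by (simp add: mat_sum_def)

lemma dim_mat_sum [simp]: "dim_row (mat_sum n m l A) = n" "dim_col (mat_sum n m l A) = m"
  by (simp_all add: mat_sum_def)

lemma index_mat_sum [simp]:
  "i < n \<Longrightarrow> j < m \<Longrightarrow> mat_sum n m l A $$ (i, j) = (\<Sum>k<l. A k $$ (i, j))"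
  by (simp add: mat_sum_def)

lemma mat_sum_cong:
  "(\<And>k. k < l \<Longrightarrow> A k = B k) \<Longrightarrow> mat_sum n m l A = mat_sum n m l B"
  by (auto simp: mat_sum_def)

lemma compress_mat_sum:
  fixes smul :: "complex \<Rightarrow> 'v::ab_group_add \<Rightarrow> 'v"
  assumes vs: "vector_space smul" and c: "\<alpha> \<in> carrier_mat r n" "\<beta> \<in> carrier_mat s m"
    "\<And>k. k < l \<Longrightarrow> v k \<in> carrier_mat r s"
  shows "compress smul \<alpha> (mat_sum r s l v) \<beta> = mat_sum n m l (\<lambda>k. compress smul \<alpha> (v k) \<beta>)"
proof (rule eq_matI)
  interpret vector_space smul by fact
  fix i j assume "i < dim_row (mat_sum n m l (\<lambda>k. compress smul \<alpha> (v k) \<beta>))"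
    and "j < dim_col (mat_sum n m l (\<lambda>k. compress smul \<alpha> (v k) \<beta>))"
  then have ij: "i < n" "j < m" by auto
  have "compress smul \<alpha> (mat_sum r s l v) \<beta> $$ (i, j) =
      (\<Sum>p<r. \<Sum>q<s. \<Sum>k<l. smul (cnj (\<alpha> $$ (p, i)) * \<beta> $$ (q, j)) (v k $$ (p, q)))"
    using c ij by (subst index_compress) (auto simp: scale_sum_right)
  also have "\<dots> = (\<Sum>k<l. \<Sum>p<r. \<Sum>q<s. smul (cnj (\<alpha> $$ (p, i)) * \<beta> $$ (q, j)) (v k $$ (p, q)))"
    by (subst sum.swap, subst sum.swap) (rule refl)
  also have "\<dots> = (\<Sum>k<l. compress smul \<alpha> (v k) \<beta> $$ (i, j))"
    using c ij by (intro sum.cong refl index_compress[symmetric]) auto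
  finally show "compress smul \<alpha> (mat_sum r s l v) \<beta> $$ (i, j) =
      mat_sum n m l (\<lambda>k. compress smul \<alpha> (v k) \<beta>) $$ (i, j)"
    using ij by simp
qed (use c in auto)

lemma compress_one:
  fixes smul :: "complex \<Rightarrow> 'v::ab_group_add \<Rightarrow> 'v"
  assumes "vector_space smul" and v: "v \<in> carrier_mat n m"
  shows "compress smul (1\<^sub>m n) v (1\<^sub>m m) = v"
proof (rule eq_matI)
  interpret vector_space smul by fact
  fix i j assume "i < dim_row v" "j < dim_col v"
  then have ij: "i < n" "j < m" using v by auto
  have "compress smul (1\<^sub>m n) v (1\<^sub>m m) $$ (i, j) =
      (\<Sum>p<n. \<Sum>q<m. smul (cnj (1\<^sub>m n $$ (p, i)) * 1\<^sub>m m $$ (q, j)) (v $$ (p, q)))"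
    using v ij by (intro index_compress) auto
  also have "\<dots> = (\<Sum>p<n. \<Sum>q<m. if q = j then if p = i then v $$ (p, q) else 0 else 0)"
    using ij by (intro sum.cong refl) auto
  also have "\<dots> = v $$ (i, j)" using ij by simp
  finally show "compress smul (1\<^sub>m n) v (1\<^sub>m m) $$ (i, j) = v $$ (i, j)" .
qed (use v in auto)

lemma compress_smult:
  fixes smul :: "complex \<Rightarrow> 'v::ab_group_add \<Rightarrow> 'v"
  assumes "vector_space smul"
    and c: "\<alpha> \<in> carrier_mat r n" "v \<in> carrier_mat r s" "\<beta> \<in> carrier_mat s m"
  shows "compress smul (a \<cdot>\<^sub>m \<alpha>) v (b \<cdot>\<^sub>m \<beta>) = map_mat (smul (cnj a * b)) (compress smul \<alpha> v \<beta>)"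
proof (rule eq_matI)
  interpret vector_space smul by fact
  fix i j assume "i < dim_row (map_mat (smul (cnj a * b)) (compress smul \<alpha> v \<beta>))"
    "j < dim_col (map_mat (smul (cnj a * b)) (compress smul \<alpha> v \<beta>))"
  then have ij: "i < n" "j < m" using c by auto
  have "compress smul (a \<cdot>\<^sub>m \<alpha>) v (b \<cdot>\<^sub>m \<beta>) $$ (i, j) =
      (\<Sum>p<r. \<Sum>q<s. smul (cnj ((a \<cdot>\<^sub>m \<alpha>) $$ (p, i)) * (b \<cdot>\<^sub>m \<beta>) $$ (q, j)) (v $$ (p, q)))"
    using c ij by (intro index_compress) auto
  also have "\<dots> = (\<Sum>p<r. \<Sum>q<s. smul (cnj a * b) (smul (cnj (\<alpha> $$ (p, i)) * \<beta> $$ (q, j)) (v $$ (p, q))))"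
    using c ij by (intro sum.cong refl) (auto simp: mult_ac)
  also have "\<dots> = smul (cnj a * b) (compress smul \<alpha> v \<beta> $$ (i, j))"
    using c ij by (simp add: index_compress scale_sum_right)
  finally show "compress smul (a \<cdot>\<^sub>m \<alpha>) v (b \<cdot>\<^sub>m \<beta>) $$ (i, j) =
      map_mat (smul (cnj a * b)) (compress smul \<alpha> v \<beta>) $$ (i, j)"
    using c ij by simp
qed (use c in auto)

lemma gram_carrier [simp]: "\<alpha> \<in> carrier_mat r n \<Longrightarrow> mat_adjoint \<alpha> * \<alpha> \<in> carrier_mat n n"
  by (rule mult_carrier_mat) auto

lemma gram_smult:
  fixes \<alpha> :: "complex mat"
  shows "mat_adjoint (a \<cdot>\<^sub>m \<alpha>) * (a \<cdot>\<^sub>m \<alpha>) = (cnj a * a) \<cdot>\<^sub>m (mat_adjoint \<alpha> * \<alpha>)"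
  by (intro eq_matI)
    (auto simp: index_gram_mat sum_distrib_left mult_ac simp del: index_mult_mat(1))

lemma compress_zero_left:
  assumes "vector_space smul" and c: "v \<in> carrier_mat r s" "\<beta> \<in> carrier_mat s m"
  shows "compress smul (0\<^sub>m r n) v \<beta> = 0\<^sub>m n m"
proof -
  interpret vector_space smul by fact
  show ?thesis using c by (intro eq_matI) (auto simp: index_compress[where r = r and s = s and n = n and m = m])
qed

lemma compress_zero_right:
  assumes "vector_space smul" and c: "v \<in> carrier_mat r s" "\<alpha> \<in> carrier_mat r n"
  shows "compress smul \<alpha> v (0\<^sub>m s m) = 0\<^sub>m n m"
proof -
  interpret vector_space smul by fact
  show ?thesis using c by (intro eq_matI) (auto simp: index_compress[where r = r and s = s and n = n and m = m])
qed

lemma compress_zero_middle: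
  assumes "vector_space smul" and c: "\<alpha> \<in> carrier_mat r n" "\<beta> \<in> carrier_mat s m"
  shows "compress smul \<alpha> (0\<^sub>m r s) \<beta> = 0\<^sub>m n m"
proof -
  interpret vector_space smul by fact
  show ?thesis using c by (intro eq_matI) (auto simp: index_compress[where r = r and s = s and n = n and m = m])
qed

text \<open>Compressing once more, by right inverses of \<alpha> and \<beta>, recovers the matrix in
  the middle.\<close>

lemma compress_cancel:
  fixes smul :: "complex \<Rightarrow> 'v::ab_group_add \<Rightarrow> 'v"
  assumes vs: "vector_space smul"
    and c: "\<alpha> \<in> carrier_mat r n" "v \<in> carrier_mat r s" "v' \<in> carrier_mat r s" "\<beta> \<in> carrier_mat s m"
    and ri: "right_invertible_mat \<alpha>" "right_invertible_mat \<beta>"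
    and eq: "compress smul \<alpha> v \<beta> = compress smul \<alpha> v' \<beta>"
  shows "v = v'"
proof -
  obtain A where A: "A \<in> carrier_mat n r" "\<alpha> * A = 1\<^sub>m r"
    using ri(1) c by (auto simp: right_invertible_mat_def inverts_mat_def)
  obtain B where B: "B \<in> carrier_mat m s" "\<beta> * B = 1\<^sub>m s"
    using ri(2) c by (auto simp: right_invertible_mat_def inverts_mat_def)
  have "u = compress smul A (compress smul \<alpha> u \<beta>) B" if "u \<in> carrier_mat r s" for u
    using compress_compress[OF vs c(1) that c(4) A(1) B(1)] compress_one[OF vs that] A B by simp
  with c eq show ?thesis by metis
qed

subsection \<open>Rectangular matrix convex sets\<close>

lemma vec_l2_norm_nonneg [simp]: "0 \<le> vec_l2_norm x"
  by (simp add: vec_l2_norm_def)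

lemma vec_l2_norm_smult: "vec_l2_norm (c \<cdot>\<^sub>v x) = cmod c * vec_l2_norm x"
proof -
  have "vec_l2_norm (c \<cdot>\<^sub>v x) = L2_set (\<lambda>i. cmod c * cmod (x $ i)) {..<dim_vec x}"
    unfolding vec_l2_norm_def by (intro L2_set_cong) (auto simp: norm_mult)
  then show ?thesis by (simp add: vec_l2_norm_def L2_set_right_distrib)
qed

text \<open>A real supremum is meaningful only over a nonempty bounded set; the zero vector and the
  bound \<open>C\<close> provide this. Nonnegativity is recorded because the convexity condition
  bounds a product of two norms, which is obtained by bounding each factor.\<close>

lemma mat_op_norm_bounds:
  assumes A: "A \<in> carrier_mat n m" and C: "0 \<le> C"
    and bound: "\<And>x. x \<in> carrier_vec m \<Longrightarrow> vec_l2_norm (A *\<^sub>v x) \<le> C * vec_l2_norm x"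
  shows "0 \<le> mat_op_norm A" "mat_op_norm A \<le> C"
proof -
  let ?B = "{x \<in> carrier_vec (dim_col A). vec_l2_norm x \<le> 1}"
  have le: "vec_l2_norm (A *\<^sub>v x) \<le> C" if "x \<in> ?B" for x
  proof -
    have "vec_l2_norm (A *\<^sub>v x) \<le> C * vec_l2_norm x" using that A by (intro bound) auto
    also have "\<dots> \<le> C * 1" using that C by (intro mult_left_mono) auto
    finally show ?thesis by simp
  qed
  have mem: "0\<^sub>v (dim_col A) \<in> ?B"
    by (simp add: vec_l2_norm_def L2_set_def)
  show "mat_op_norm A \<le> C"
    unfolding mat_op_norm_def
  proof (rule cSUP_least)
    show "?B \<noteq> {}" using mem by blast
  qed (rule le)
  have "0 \<le> vec_l2_norm (A *\<^sub>v 0\<^sub>v (dim_col A))" by simp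
  also have "\<dots> \<le> mat_op_norm A"
    unfolding mat_op_norm_def
    by (rule cSUP_upper[OF mem]) (rule bdd_aboveI2[of _ _ C], rule le)
  finally show "0 \<le> mat_op_norm A" .
qed

text \<open>A bound for the operator norm that is continuous in the entries and exact at the identity matrix.\<close>

definition unit_norm_bound :: "nat \<Rightarrow> (nat \<times> nat \<Rightarrow> complex) \<Rightarrow> real" where
  "unit_norm_bound n f = 1 + (\<Sum>i<n. \<Sum>j<n. cmod (f (i, j) - (if i = j then 1 else 0)))"

lemma unit_norm_bound_ge_1: "1 \<le> unit_norm_bound n f"
  unfolding unit_norm_bound_def by (simp add: sum_nonneg)

text \<open>Write \<open>A\<close> as the identity plus \<open>E\<close>. The error \<open>E\<close>
  applied to \<open>x\<close> has norm at most the sum of the moduli of the entries of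
  \<open>E\<close> times the norm of \<open>x\<close>.\<close>

lemma vec_l2_norm_mult_le:
  fixes A :: "complex mat"
  assumes A: "A \<in> carrier_mat n n" and x: "x \<in> carrier_vec n"
  shows "vec_l2_norm (A *\<^sub>v x) \<le> unit_norm_bound n (($$) A) * vec_l2_norm x"
proof -
  define E where "E = (\<lambda>i j. A $$ (i, j) - (if i = j then 1 else 0))"
  let ?x = "vec_l2_norm x"
  have Ax: "(A *\<^sub>v x) $ i = x $ i + (\<Sum>j<n. E i j * x $ j)" if "i < n" for i
  proof -
    have "(A *\<^sub>v x) $ i = (\<Sum>j<n. A $$ (i, j) * x $ j)"
      using that A x by (auto simp: scalar_prod_def lessThan_atLeast0)
    also have "\<dots> = (\<Sum>j<n. E i j * x $ j + (if i = j then x $ j else 0))"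
      by (intro sum.cong) (auto simp: E_def algebra_simps)
    also have "\<dots> = x $ i + (\<Sum>j<n. E i j * x $ j)"
      using that by (simp add: sum.distrib)
    finally show ?thesis .
  qed
  have "vec_l2_norm (A *\<^sub>v x) = L2_set (\<lambda>i. cmod ((A *\<^sub>v x) $ i)) {..<n}"
    using A by (simp add: vec_l2_norm_def)
  also have "\<dots> \<le> L2_set (\<lambda>i. cmod (x $ i) + (\<Sum>j<n. cmod (E i j) * ?x)) {..<n}"
  proof (rule L2_set_mono)
    fix i assume "i \<in> {..<n}"
    then have i: "i < n" by simp
    have "cmod ((A *\<^sub>v x) $ i) \<le> cmod (x $ i) + (\<Sum>j<n. cmod (E i j * x $ j))"
      unfolding Ax[OF i] by (intro order_trans[OF norm_triangle_ineq] add_left_mono norm_sum)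
    also have "\<dots> \<le> cmod (x $ i) + (\<Sum>j<n. cmod (E i j) * ?x)"
    proof (intro add_left_mono sum_mono)
      fix j assume "j \<in> {..<n}"
      then have "cmod (x $ j) \<le> ?x"
        using x unfolding vec_l2_norm_def by (intro member_le_L2_set) auto
      then show "cmod (E i j * x $ j) \<le> cmod (E i j) * ?x"
        by (simp add: norm_mult mult_left_mono)
    qed
    finally show "cmod ((A *\<^sub>v x) $ i) \<le> cmod (x $ i) + (\<Sum>j<n. cmod (E i j) * ?x)" .
  qed simp
  also have "\<dots> \<le> L2_set (\<lambda>i. cmod (x $ i)) {..<n} + L2_set (\<lambda>i. \<Sum>j<n. cmod (E i j) * ?x) {..<n}"
    by (rule L2_set_triangle_ineq)
  also have "\<dots> \<le> ?x + (\<Sum>i<n. \<Sum>j<n. cmod (E i j) * ?x)"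
    using x by (intro add_mono L2_set_le_sum) (auto simp: vec_l2_norm_def intro!: sum_nonneg mult_nonneg_nonneg)
  also have "\<dots> = unit_norm_bound n (($$) A) * ?x"
    by (simp add: unit_norm_bound_def E_def distrib_right sum_distrib_right)
  finally show ?thesis .
qed

lemma mat_op_norm_smult_bounds:
  fixes A :: "complex mat"
  assumes A: "A \<in> carrier_mat n n"
  shows "0 \<le> mat_op_norm (c \<cdot>\<^sub>m A)" "mat_op_norm (c \<cdot>\<^sub>m A) \<le> cmod c * unit_norm_bound n (($$) A)"
proof -
  have N: "0 \<le> unit_norm_bound n (($$) A)"
    using unit_norm_bound_ge_1[of n "($$) A"] by linarith
  have "vec_l2_norm ((c \<cdot>\<^sub>m A) *\<^sub>v x) \<le> cmod c * unit_norm_bound n (($$) A) * vec_l2_norm x"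
    if x: "x \<in> carrier_vec n" for x
  proof -
    have "(c \<cdot>\<^sub>m A) *\<^sub>v x = c \<cdot>\<^sub>v (A *\<^sub>v x)"
      using A x by (intro eq_vecI) (auto simp: scalar_prod_def sum_distrib_left mult.assoc)
    then show ?thesis
      using vec_l2_norm_mult_le[OF A x] by (simp add: vec_l2_norm_smult mult_left_mono mult.assoc)
  qed
  then show "0 \<le> mat_op_norm (c \<cdot>\<^sub>m A)" "mat_op_norm (c \<cdot>\<^sub>m A) \<le> cmod c * unit_norm_bound n (($$) A)"
    using A N mat_op_norm_bounds[of "c \<cdot>\<^sub>m A" n n "cmod c * unit_norm_bound n (($$) A)"] by simp_all
qed

lemma mat_op_norm_one_le: "0 \<le> mat_op_norm (1\<^sub>m n)" "mat_op_norm (1\<^sub>m n) \<le> 1"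
proof -
  have "1 \<cdot>\<^sub>m 1\<^sub>m n = (1\<^sub>m n :: complex mat)" by (intro eq_matI) auto
  moreover have "unit_norm_bound n (($$) (1\<^sub>m n)) = 1"
    by (simp add: unit_norm_bound_def)
  ultimately show "0 \<le> mat_op_norm (1\<^sub>m n)" "mat_op_norm (1\<^sub>m n) \<le> 1"
    using mat_op_norm_smult_bounds[of "1\<^sub>m n" n 1] by auto
qed

lemma mat_op_norm_zero_le: "0 \<le> mat_op_norm (0\<^sub>m n n)" "mat_op_norm (0\<^sub>m n n) \<le> 1"
proof -
  have "0 \<cdot>\<^sub>m 1\<^sub>m n = (0\<^sub>m n n :: complex mat)" by (intro eq_matI) auto
  then show "0 \<le> mat_op_norm (0\<^sub>m n n)" "mat_op_norm (0\<^sub>m n n) \<le> 1"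
    using mat_op_norm_smult_bounds[of "1\<^sub>m n" n 0] by auto
qed

section \<open>Closure properties of rectangular matrix convex sets\<close>

lemma rect_matrix_convexD:
  assumes "rect_matrix_convex smul K" "0 < n" "0 < m" "combination_data K n m l r s \<alpha> v \<beta>"
    and "0 \<le> mat_op_norm (mat_sum n n l (\<lambda>k. mat_adjoint (\<alpha> k) * \<alpha> k))"
    and "mat_op_norm (mat_sum n n l (\<lambda>k. mat_adjoint (\<alpha> k) * \<alpha> k)) \<le> 1"
    and "0 \<le> mat_op_norm (mat_sum m m l (\<lambda>k. mat_adjoint (\<beta> k) * \<beta> k))"
    and "mat_op_norm (mat_sum m m l (\<lambda>k. mat_adjoint (\<beta> k) * \<beta> k)) \<le> 1"
  shows "mat_sum n m l (\<lambda>k. compress smul (\<alpha> k) (v k) (\<beta> k)) \<in> K n m"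
  by (rule assms(1)[unfolded rect_matrix_convex_def, THEN conjunct2, rule_format,
      OF assms(2,3) conjI[OF assms(4) mult_le_one[OF assms(6-8)]]])

lemma rect_matrix_convex_carrier:
  "rect_matrix_convex smul K \<Longrightarrow> v \<in> K n m \<Longrightarrow> 0 < n \<Longrightarrow> 0 < m \<Longrightarrow> v \<in> carrier_mat n m"
  unfolding rect_matrix_convex_def collection_le_def by blast

lemma mat_sum_single: "A 0 \<in> carrier_mat n m \<Longrightarrow> mat_sum n m 1 A = A 0"
  by (intro eq_matI) auto

text \<open>A combination with one term. The Gram matrix 1 covers isometries and unitaries; the Gram
  matrix 0 covers zero coefficients, which put zero matrices into all levels.\<close>

lemma rect_matrix_convex_compress:
  assumes K: "rect_matrix_convex smul K" and v: "v \<in> K n m"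
    and pos: "0 < n" "0 < m" "0 < r" "0 < s"
    and Q: "Q \<in> carrier_mat n r" "mat_adjoint Q * Q \<in> {0\<^sub>m r r, 1\<^sub>m r}"
    and R: "R \<in> carrier_mat m s" "mat_adjoint R * R \<in> {0\<^sub>m s s, 1\<^sub>m s}"
  shows "compress smul Q v R \<in> K r s"
proof -
  have "mat_sum r s 1 (\<lambda>k. compress smul Q v R) \<in> K r s"
  proof (rule rect_matrix_convexD[OF K pos(3,4)])
    show "combination_data K r s 1 (\<lambda>_. n) (\<lambda>_. m) (\<lambda>_. Q) (\<lambda>_. v) (\<lambda>_. R)"
      using assms by (auto simp: combination_data_def)
    have "mat_sum r r 1 (\<lambda>k. mat_adjoint Q * Q) = mat_adjoint Q * Q"
      using Q(2) by (intro mat_sum_single) auto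
    then show "0 \<le> mat_op_norm (mat_sum r r 1 (\<lambda>k. mat_adjoint Q * Q))"
      "mat_op_norm (mat_sum r r 1 (\<lambda>k. mat_adjoint Q * Q)) \<le> 1"
      using Q(2) mat_op_norm_one_le mat_op_norm_zero_le by auto
    have "mat_sum s s 1 (\<lambda>k. mat_adjoint R * R) = mat_adjoint R * R"
      using R(2) by (intro mat_sum_single) auto
    then show "0 \<le> mat_op_norm (mat_sum s s 1 (\<lambda>k. mat_adjoint R * R))"
      "mat_op_norm (mat_sum s s 1 (\<lambda>k. mat_adjoint R * R)) \<le> 1"
      using R(2) mat_op_norm_one_le mat_op_norm_zero_le by auto
  qed
  moreover have "mat_sum r s 1 (\<lambda>k. compress smul Q v R) = compress smul Q v R"
    using Q R by (intro mat_sum_single) auto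
  ultimately show ?thesis by simp
qed

lemma rect_matrix_convex_zero:
  assumes vs: "vector_space smul" and K: "rect_matrix_convex smul K" and v: "v \<in> K n m"
    and pos: "0 < n" "0 < m" "0 < r" "0 < s"
  shows "0\<^sub>m r s \<in> K r s"
proof -
  have "compress smul (0\<^sub>m n r) v (0\<^sub>m m s) \<in> K r s"
    by (rule rect_matrix_convex_compress[OF K v pos]) auto
  moreover have "compress smul (0\<^sub>m n r) v (0\<^sub>m m s) = 0\<^sub>m r s"
    using rect_matrix_convex_carrier[OF K v] pos by (intro compress_zero_left[OF vs]) auto
  ultimately show ?thesis by simp
qed

lemma mat_sum_smult: "mat_sum n m l (\<lambda>k. c \<cdot>\<^sub>m A k) = c \<cdot>\<^sub>m mat_sum n m l A"
  if "\<And>k. k < l \<Longrightarrow> A k \<in> carrier_mat n m" for A :: "nat \<Rightarrow> 'a::comm_ring_1 mat"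
  by (intro eq_matI) (auto simp: sum_distrib_left carrier_matD[OF that] intro!: sum.cong)

lemma mat_sum_map_mat_smul:
  assumes "vector_space smul" and "\<And>k. k < l \<Longrightarrow> A k \<in> carrier_mat n m"
  shows "mat_sum n m l (\<lambda>k. map_mat (smul c) (A k)) = map_mat (smul c) (mat_sum n m l A)"
proof -
  interpret vector_space smul by fact
  show ?thesis by (intro eq_matI) (auto simp: scale_sum_right carrier_matD[OF assms(2)] intro!: sum.cong)
qed

text \<open>Coefficients on the left and on the right are rescaled separately, so that both Gram
  sums get norm at most 1. The resulting scalar is continuous in \<open>A\<close> and
  \<open>B\<close> and equals 1 if both are identities.\<close>

lemma rect_matrix_convex_normalized:
  assumes vs: "vector_space smul" and L: "rect_matrix_convex smul L" and pos: "0 < n" "0 < m"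
    and data: "combination_data L n m l r s \<alpha> v \<beta>"
  defines "A \<equiv> mat_sum n n l (\<lambda>k. mat_adjoint (\<alpha> k) * \<alpha> k)"
    and "B \<equiv> mat_sum m m l (\<lambda>k. mat_adjoint (\<beta> k) * \<beta> k)"
  shows "map_mat (smul (of_real (1 / sqrt (unit_norm_bound n (($$) A)) * (1 / sqrt (unit_norm_bound m (($$) B))))))
    (mat_sum n m l (\<lambda>k. compress smul (\<alpha> k) (v k) (\<beta> k))) \<in> L n m"
proof -
  define a b where "a = 1 / sqrt (unit_norm_bound n (($$) A))" and "b = 1 / sqrt (unit_norm_bound m (($$) B))"
  define \<alpha>' \<beta>' where "\<alpha>' = (\<lambda>k. of_real a \<cdot>\<^sub>m \<alpha> k)" and "\<beta>' = (\<lambda>k. of_real b \<cdot>\<^sub>m \<beta> k)"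
  have car: "\<alpha> k \<in> carrier_mat (r k) n" "\<beta> k \<in> carrier_mat (s k) m" "v k \<in> carrier_mat (r k) (s k)"
    if "k < l" for k
    using data that rect_matrix_convex_carrier[OF L] by (auto simp: combination_data_def)
  have data': "combination_data L n m l r s \<alpha>' v \<beta>'"
    using data by (auto simp: combination_data_def \<alpha>'_def \<beta>'_def)
  have A': "mat_sum n n l (\<lambda>k. mat_adjoint (\<alpha>' k) * \<alpha>' k) = of_real (a * a) \<cdot>\<^sub>m A"
    unfolding A_def using car by (subst mat_sum_smult[symmetric]) (auto simp: \<alpha>'_def gram_smult intro: gram_carrier)
  have B': "mat_sum m m l (\<lambda>k. mat_adjoint (\<beta>' k) * \<beta>' k) = of_real (b * b) \<cdot>\<^sub>m B"
    unfolding B_def using car by (subst mat_sum_smult[symmetric]) (auto simp: \<beta>'_def gram_smult intro: gram_carrier)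
  have aa: "cmod (of_real (a * a)) * unit_norm_bound n (($$) A) = 1"
    using unit_norm_bound_ge_1[of n "($$) A"] unfolding norm_of_real by (simp add: a_def)
  have bb: "cmod (of_real (b * b)) * unit_norm_bound m (($$) B) = 1"
    using unit_norm_bound_ge_1[of m "($$) B"] unfolding norm_of_real by (simp add: b_def)
  have cA: "A \<in> carrier_mat n n" and cB: "B \<in> carrier_mat m m"
    by (simp_all add: A_def B_def)
  have "mat_sum n m l (\<lambda>k. compress smul (\<alpha>' k) (v k) (\<beta>' k)) \<in> L n m"
    using mat_op_norm_smult_bounds[OF cA, of "of_real (a * a)"] mat_op_norm_smult_bounds[OF cB, of "of_real (b * b)"]
    unfolding aa bb by (intro rect_matrix_convexD[OF L pos data']) (simp_all only: A' B')
  also have "mat_sum n m l (\<lambda>k. compress smul (\<alpha>' k) (v k) (\<beta>' k)) =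
      mat_sum n m l (\<lambda>k. map_mat (smul (of_real (a * b))) (compress smul (\<alpha> k) (v k) (\<beta> k)))"
    by (intro mat_sum_cong) (simp add: \<alpha>'_def \<beta>'_def compress_smult[OF vs car(1,3,2)])
  also have "\<dots> = map_mat (smul (of_real (a * b))) (mat_sum n m l (\<lambda>k. compress smul (\<alpha> k) (v k) (\<beta> k)))"
    by (intro mat_sum_map_mat_smul[OF vs] compress_carrier[OF car(1,2)])
  finally show ?thesis by (simp only: a_def b_def)
qed

text \<open>Extension by zero places matrices of all sizes in one type with its product topology,
  where the results on locally convex spaces apply. On a fixed carrier it is injective, with left
  inverse \<open>mat n m\<close>.\<close>

definition mat_fun :: "'a::zero mat \<Rightarrow> nat \<times> nat \<Rightarrow> 'a" where
  "mat_fun A = (\<lambda>(i, j). if i < dim_row A \<and> j < dim_col A then A $$ (i, j) else 0)"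

lemma mat_fun_apply: "A \<in> carrier_mat n m \<Longrightarrow> mat_fun A (i, j) = (if i < n \<and> j < m then A $$ (i, j) else 0)"
  by (auto simp: mat_fun_def)

lemma mat_mat_fun: "A \<in> carrier_mat n m \<Longrightarrow> mat n m (mat_fun A) = A"
  by (intro eq_matI) (auto simp: mat_fun_def)

lemma mat_fun_inject:
  "A \<in> carrier_mat n m \<Longrightarrow> B \<in> carrier_mat n m \<Longrightarrow> mat_fun A = mat_fun B \<longleftrightarrow> A = B"
  by (metis mat_mat_fun)

section \<open>The matrix topology seen through functions on index pairs\<close>

lemma topspace_mat_topology [simp]: "topspace (mat_topology n m) = carrier_mat n m"
  by (auto simp: mat_topology_def topspace_pullback_topology)

lemma continuous_map_mat_fun:
  "continuous_map (mat_topology n m) euclidean (mat_fun :: 'v::{topological_space, zero} mat \<Rightarrow> _)"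
proof -
  have "continuous_map (mat_topology n m) euclidean (\<lambda>A::'v mat. mat_fun A (i, j))" for i j
  proof (cases "i < n \<and> j < m")
    case True
    have "continuous_map (mat_topology n m) euclidean
        ((\<lambda>f. f (i, j)) \<circ> (\<lambda>A::'v mat. restrict (\<lambda>(i, j). A $$ (i, j)) ({..<n} \<times> {..<m})))"
      unfolding mat_topology_def using True
      by (intro continuous_map_pullback continuous_map_product_projection) auto
    then show ?thesis
      by (rule continuous_map_eq) (use True in \<open>auto simp: mat_fun_def\<close>)
  next
    case False
    have "continuous_map (mat_topology n m) euclidean (\<lambda>A::'v mat. 0 :: 'v)" by simp
    then show ?thesis
      by (rule continuous_map_eq) (use False in \<open>auto simp: mat_fun_def\<close>)
  qed
  then have "continuous_map (mat_topology n m) (product_topology (\<lambda>_. euclidean) UNIV) (mat_fun :: 'v mat \<Rightarrow> _)"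
    by (simp add: continuous_map_componentwise_UNIV)
  then show ?thesis by (simp add: euclidean_product_topology)
qed

lemma continuous_map_mat: "continuous_map euclidean (mat_topology n m) (mat n m)"
  unfolding mat_topology_def
proof (rule continuous_map_pullback')
  have "continuous_map euclidean euclidean (\<lambda>f::nat \<times> nat \<Rightarrow> 'a. f k)" for k
    by simp
  then show "continuous_map euclidean (product_topology (\<lambda>_. euclidean) ({..<n} \<times> {..<m}))
      ((\<lambda>A. restrict (\<lambda>(i, j). A $$ (i, j)) ({..<n} \<times> {..<m})) \<circ> mat n m)"
    unfolding continuous_map_componentwise
    by (auto intro: continuous_map_eq)
qed auto

lemma compact_mat_fun_image:
  "compactin (mat_topology n m) S \<Longrightarrow> compact (mat_fun ` S)"
  using image_compactin[OF _ continuous_map_mat_fun] by fastforce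

lemma closed_mat_preimage:
  fixes S :: "'v::{topological_space, zero} mat set"
  assumes "closedin (mat_topology n m) S"
  shows "closed {f. mat n m f \<in> S}"
  using closedin_continuous_map_preimage[OF continuous_map_mat assms] by simp

text \<open>The image under \<open>mat_fun\<close> is compact in a Hausdorff space, hence closed,
  and by injectivity its preimage is \<open>S\<close>.\<close>

lemma compactin_imp_closedin_mat_topology:
  fixes S :: "'v::{t2_space, zero} mat set"
  assumes S: "compactin (mat_topology n m) S"
  shows "closedin (mat_topology n m) S"
proof -
  have "closed (mat_fun ` S)" by (rule compact_imp_closed[OF compact_mat_fun_image[OF S]])
  then have "closedin (mat_topology n m) {A \<in> topspace (mat_topology n m). mat_fun A \<in> mat_fun ` S}"
    by (intro closedin_continuous_map_preimage[OF continuous_map_mat_fun]) simp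
  moreover have "{A \<in> topspace (mat_topology n m). mat_fun A \<in> mat_fun ` S} = S"
    using compactin_subset_topspace[OF S] by (auto simp: mat_fun_inject)
  ultimately show ?thesis by simp
qed

subsection \<open>Triples\<close>

definition gram where
  "gram smul \<alpha> v \<beta> = (mat_fun (mat_adjoint \<alpha> * \<alpha>), mat_fun (mat_adjoint \<beta> * \<beta>), mat_fun (compress smul \<alpha> v \<beta>))"

text \<open>Scaling by a nonnegative real \<open>t\<close> amounts to multiplying both \<alpha> and
  \<beta> by the square root of \<open>t\<close>, so cones of triples are stable under it.\<close>

definition scale_triple ::
  "(complex \<Rightarrow> 'v \<Rightarrow> 'v) \<Rightarrow> real \<Rightarrow> ('a \<Rightarrow> complex) \<times> ('a \<Rightarrow> complex) \<times> ('a \<Rightarrow> 'v) \<Rightarrow> _" where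
  "scale_triple smul c p = ((\<lambda>i. c *\<^sub>R fst p i), (\<lambda>i. c *\<^sub>R fst (snd p) i), (\<lambda>i. smul (of_real c) (snd (snd p) i)))"

lemma (in locally_convex_tvs) real_lctvs_scale_triple: "real_lctvs (scale_triple smul)"
  unfolding scale_triple_def[abs_def]
  by (rule real_lctvs_prod[OF real_lctvs_fun[OF real_lctvs_scaleR]
        real_lctvs_prod[OF real_lctvs_fun[OF real_lctvs_scaleR] real_lctvs_fun[OF real_lctvs_smul]]])

lemma vector_space_complex: "vector_space ((*) :: complex \<Rightarrow> complex \<Rightarrow> complex)"
  by standard (simp_all add: algebra_simps)

text \<open>With the complex numbers as vector space, a Gram matrix is a compression of the
  identity. Composition, sums and cancellation for all three components of a triple then follow from
  the same lemmas.\<close>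

lemma gram_mat_eq_compress:
  fixes \<alpha> :: "complex mat"
  assumes "\<alpha> \<in> carrier_mat r n"
  shows "mat_adjoint \<alpha> * \<alpha> = compress (*) \<alpha> (1\<^sub>m r) \<alpha>"
proof (rule eq_matI)
  fix i j assume "i < dim_row (compress (*) \<alpha> (1\<^sub>m r) \<alpha>)" "j < dim_col (compress (*) \<alpha> (1\<^sub>m r) \<alpha>)"
  then have ij: "i < n" "j < n" using assms by auto
  have "compress (*) \<alpha> (1\<^sub>m r) \<alpha> $$ (i, j) =
      (\<Sum>p<r. \<Sum>q<r. cnj (\<alpha> $$ (p, i)) * \<alpha> $$ (q, j) * 1\<^sub>m r $$ (p, q))"
    using assms ij by (intro index_compress) auto
  also have "\<dots> = (\<Sum>p<r. \<Sum>q<r. if p = q then cnj (\<alpha> $$ (p, i)) * \<alpha> $$ (q, j) else 0)"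
    by (intro sum.cong refl) auto
  also have "\<dots> = (\<Sum>p<r. cnj (\<alpha> $$ (p, i)) * \<alpha> $$ (p, j))" by simp
  also have "\<dots> = (mat_adjoint \<alpha> * \<alpha>) $$ (i, j)"
    using assms ij by (subst index_gram_mat) auto
  finally show "(mat_adjoint \<alpha> * \<alpha>) $$ (i, j) = compress (*) \<alpha> (1\<^sub>m r) \<alpha> $$ (i, j)" ..
qed (use assms in auto)

lemma gram_mat_mult:
  fixes \<alpha> \<gamma> :: "complex mat"
  assumes "\<gamma> \<in> carrier_mat r' r" "\<alpha> \<in> carrier_mat r n"
  shows "mat_adjoint (\<gamma> * \<alpha>) * (\<gamma> * \<alpha>) = compress (*) \<alpha> (mat_adjoint \<gamma> * \<gamma>) \<alpha>"
  using gram_mat_eq_compress[OF mult_carrier_mat[OF assms]] gram_mat_eq_compress[OF assms(1)]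
    compress_compress[OF vector_space_complex assms(1) one_carrier_mat assms(1,2,2)]
  by simp

lemma gram_mult:
  assumes vs: "vector_space smul"
    and c: "\<gamma> \<in> carrier_mat r' r" "v \<in> carrier_mat r' s'" "\<delta> \<in> carrier_mat s' s"
      "\<alpha> \<in> carrier_mat r n" "\<beta> \<in> carrier_mat s m"
  shows "gram smul (\<gamma> * \<alpha>) v (\<delta> * \<beta>) =
    (mat_fun (compress (*) \<alpha> (mat_adjoint \<gamma> * \<gamma>) \<alpha>), mat_fun (compress (*) \<beta> (mat_adjoint \<delta> * \<delta>) \<beta>),
     mat_fun (compress smul \<alpha> (compress smul \<gamma> v \<delta>) \<beta>))"
  using c by (simp add: gram_def gram_mat_mult compress_compress[OF vs c])

text \<open>An isometric left factor does not change a Gram matrix, so it can be moved from the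
  coefficients into the middle matrix.\<close>

lemma gram_isometry:
  assumes vs: "vector_space smul"
    and c: "\<gamma> \<in> carrier_mat r' r" "v \<in> carrier_mat r' s'" "\<delta> \<in> carrier_mat s' s"
      "\<alpha> \<in> carrier_mat r n" "\<beta> \<in> carrier_mat s m"
    and iso: "mat_adjoint \<gamma> * \<gamma> = 1\<^sub>m r" "mat_adjoint \<delta> * \<delta> = 1\<^sub>m s"
  shows "gram smul (\<gamma> * \<alpha>) v (\<delta> * \<beta>) = gram smul \<alpha> (compress smul \<gamma> v \<delta>) \<beta>"
  unfolding gram_mult[OF vs c] iso by (simp add: gram_def gram_mat_eq_compress[OF c(4)] gram_mat_eq_compress[OF c(5)])

lemma sum_fun_apply: "(\<Sum>a\<in>A. f a) x = (\<Sum>a\<in>A. f a x)"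
  by (induction A rule: infinite_finite_induct) auto

lemma mat_fun_mat_sum:
  assumes "\<And>k. k < l \<Longrightarrow> A k \<in> carrier_mat n m"
  shows "mat_fun (mat_sum n m l A) = (\<Sum>k<l. mat_fun (A k))"
proof (rule ext, clarify)
  fix i j
  have "mat_fun (mat_sum n m l A) (i, j) = (if i < n \<and> j < m then \<Sum>k<l. A k $$ (i, j) else 0)"
    by (simp add: mat_fun_apply[OF mat_sum_carrier])
  also have "\<dots> = (\<Sum>k<l. mat_fun (A k) (i, j))"
    by (cases "i < n \<and> j < m") (auto simp: mat_fun_apply[OF assms])
  finally show "mat_fun (mat_sum n m l A) (i, j) = (\<Sum>k<l. mat_fun (A k)) (i, j)"
    by (simp add: sum_fun_apply)
qed

lemma sum_gram:
  assumes c: "\<And>k. k < l \<Longrightarrow> \<alpha> k \<in> carrier_mat (r k) n" "\<And>k. k < l \<Longrightarrow> \<beta> k \<in> carrier_mat (s k) m"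
  shows "(\<Sum>k<l. gram smul (\<alpha> k) (v k) (\<beta> k)) =
    (mat_fun (mat_sum n n l (\<lambda>k. mat_adjoint (\<alpha> k) * \<alpha> k)),
     mat_fun (mat_sum m m l (\<lambda>k. mat_adjoint (\<beta> k) * \<beta> k)),
     mat_fun (mat_sum n m l (\<lambda>k. compress smul (\<alpha> k) (v k) (\<beta> k))))"
proof (intro prod_eqI)
  note 1 = gram_carrier[OF c(1)] and 2 = gram_carrier[OF c(2)] and 3 = compress_carrier[OF c]
  show "fst (\<Sum>k<l. gram smul (\<alpha> k) (v k) (\<beta> k)) = fst (mat_fun (mat_sum n n l (\<lambda>k. mat_adjoint (\<alpha> k) * \<alpha> k)),
     mat_fun (mat_sum m m l (\<lambda>k. mat_adjoint (\<beta> k) * \<beta> k)),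
     mat_fun (mat_sum n m l (\<lambda>k. compress smul (\<alpha> k) (v k) (\<beta> k))))"
    by (simp add: fst_sum gram_def mat_fun_mat_sum[OF 1])
  show "fst (snd (\<Sum>k<l. gram smul (\<alpha> k) (v k) (\<beta> k))) = fst (snd (mat_fun (mat_sum n n l (\<lambda>k. mat_adjoint (\<alpha> k) * \<alpha> k)),
     mat_fun (mat_sum m m l (\<lambda>k. mat_adjoint (\<beta> k) * \<beta> k)),
     mat_fun (mat_sum n m l (\<lambda>k. compress smul (\<alpha> k) (v k) (\<beta> k)))))"
    by (simp add: fst_sum snd_sum gram_def mat_fun_mat_sum[OF 2])
  show "snd (snd (\<Sum>k<l. gram smul (\<alpha> k) (v k) (\<beta> k))) = snd (snd (mat_fun (mat_sum n n l (\<lambda>k. mat_adjoint (\<alpha> k) * \<alpha> k)),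
     mat_fun (mat_sum m m l (\<lambda>k. mat_adjoint (\<beta> k) * \<beta> k)),
     mat_fun (mat_sum n m l (\<lambda>k. compress smul (\<alpha> k) (v k) (\<beta> k)))))"
    by (simp add: snd_sum gram_def mat_fun_mat_sum[OF 3])
qed

lemma mat_fun_map_mat: "f 0 = 0 \<Longrightarrow> mat_fun (map_mat f A) = (\<lambda>i. f (mat_fun A i))"
  by (auto simp: mat_fun_def)

lemma smult_eq_map_mat: "c \<cdot>\<^sub>m A = map_mat ((*) c) A"
  by (intro eq_matI) auto

lemma gram_scale:
  assumes vs: "vector_space smul" and t: "0 \<le> t"
    and c: "\<alpha> \<in> carrier_mat r n" "v \<in> carrier_mat r s" "\<beta> \<in> carrier_mat s m"
  shows "gram smul (of_real (sqrt t) \<cdot>\<^sub>m \<alpha>) v (of_real (sqrt t) \<cdot>\<^sub>m \<beta>) = scale_triple smul t (gram smul \<alpha> v \<beta>)"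
proof -
  interpret vector_space smul by fact
  have "complex_of_real (sqrt t) * complex_of_real (sqrt t) = of_real t"
    using t by (simp flip: of_real_mult)
  then have sq: "cnj (of_real (sqrt t)) * complex_of_real (sqrt t) = of_real t"
    by simp
  have "mat_fun (mat_adjoint (of_real (sqrt t) \<cdot>\<^sub>m \<gamma>) * (of_real (sqrt t) \<cdot>\<^sub>m \<gamma>)) =
      (\<lambda>i. t *\<^sub>R mat_fun (mat_adjoint \<gamma> * \<gamma>) i)" for \<gamma> :: "complex mat"
    unfolding gram_smult sq by (simp add: smult_eq_map_mat mat_fun_map_mat scaleR_conv_of_real)
  moreover have "mat_fun (compress smul (of_real (sqrt t) \<cdot>\<^sub>m \<alpha>) v (of_real (sqrt t) \<cdot>\<^sub>m \<beta>)) =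
      (\<lambda>i. smul (of_real t) (mat_fun (compress smul \<alpha> v \<beta>) i))"
    unfolding compress_smult[OF vs c] sq by (simp add: mat_fun_map_mat)
  ultimately show ?thesis
    by (simp add: gram_def scale_triple_def)
qed

text \<open>On a triple this is the sum of the squared Frobenius norms of \<alpha> and \<beta>. It
  is additive and homogeneous, so it supplies the weights of convex combinations, and it bounds
  every coefficient entry.\<close>

definition trace_sum :: "nat \<Rightarrow> nat \<Rightarrow> (nat \<times> nat \<Rightarrow> complex) \<times> (nat \<times> nat \<Rightarrow> complex) \<times> 'a \<Rightarrow> real" where
  "trace_sum n m p = (\<Sum>i<n. Re (fst p (i, i))) + (\<Sum>j<m. Re (fst (snd p) (j, j)))"

lemma trace_sum_gram:
  assumes "\<alpha> \<in> carrier_mat r n" "\<beta> \<in> carrier_mat s m"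
  shows "trace_sum n m (gram smul \<alpha> v \<beta>) =
    (\<Sum>i<n. \<Sum>p<r. (cmod (\<alpha> $$ (p, i)))\<^sup>2) + (\<Sum>j<m. \<Sum>q<s. (cmod (\<beta> $$ (q, j)))\<^sup>2)"
proof -
  have *: "Re (mat_fun (mat_adjoint \<gamma> * \<gamma>) (i, i)) = (\<Sum>p<r. (cmod (\<gamma> $$ (p, i)))\<^sup>2)"
    if "\<gamma> \<in> carrier_mat r n" "i < n" for \<gamma> r n i
  proof -
    have "mat_fun (mat_adjoint \<gamma> * \<gamma>) (i, i) = (\<Sum>p<r. cnj (\<gamma> $$ (p, i)) * \<gamma> $$ (p, i))"
      using that by (simp add: mat_fun_apply[OF gram_carrier[OF that(1)]] index_gram_mat del: index_mult_mat(1))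
    moreover have "Re (cnj z * z) = (cmod z)\<^sup>2" for z
      unfolding cmod_power2 by (simp add: power2_eq_square)
    ultimately show ?thesis by (simp only: Re_sum)
  qed
  show ?thesis using assms by (simp add: trace_sum_def gram_def *)
qed

lemma trace_sum_gram_ge_entry:
  assumes c: "\<alpha> \<in> carrier_mat r n" "\<beta> \<in> carrier_mat s m"
  shows "p < r \<Longrightarrow> i < n \<Longrightarrow> (cmod (\<alpha> $$ (p, i)))\<^sup>2 \<le> trace_sum n m (gram smul \<alpha> v \<beta>)"
    and "q < s \<Longrightarrow> j < m \<Longrightarrow> (cmod (\<beta> $$ (q, j)))\<^sup>2 \<le> trace_sum n m (gram smul \<alpha> v \<beta>)"
proof -
  have le: "f p i \<le> (\<Sum>i<n. \<Sum>p<r. f p i)" if "p < r" "i < n" "\<And>p i. 0 \<le> f p i"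
    for f :: "nat \<Rightarrow> nat \<Rightarrow> real" and p i r n
  proof -
    have "f p i \<le> (\<Sum>p<r. f p i)" using that by (intro member_le_sum) auto
    also have "\<dots> \<le> (\<Sum>i<n. \<Sum>p<r. f p i)"
      using that by (intro member_le_sum[of i _ "\<lambda>i. \<Sum>p<r. f p i"] sum_nonneg) auto
    finally show ?thesis .
  qed
  have nn: "0 \<le> (\<Sum>i<n. \<Sum>p<r. (cmod (\<gamma> $$ (p, i)))\<^sup>2)" for \<gamma> :: "complex mat" and n r :: nat
    by (intro sum_nonneg) auto
  show "(cmod (\<alpha> $$ (p, i)))\<^sup>2 \<le> trace_sum n m (gram smul \<alpha> v \<beta>)" if "p < r" "i < n"
    unfolding trace_sum_gram[OF c]
    by (rule add_increasing2[OF nn le[OF that, of "\<lambda>p i. (cmod (\<alpha> $$ (p, i)))\<^sup>2"]]) simp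
  show "(cmod (\<beta> $$ (q, j)))\<^sup>2 \<le> trace_sum n m (gram smul \<alpha> v \<beta>)" if "q < s" "j < m"
    unfolding trace_sum_gram[OF c]
    by (rule add_increasing[OF nn le[OF that, of "\<lambda>p i. (cmod (\<beta> $$ (p, i)))\<^sup>2"]]) simp
qed

lemma trace_sum_gram_pos:
  assumes c: "\<alpha> \<in> carrier_mat r n" "\<beta> \<in> carrier_mat s m" and nz: "\<alpha> \<noteq> 0\<^sub>m r n"
  shows "0 < trace_sum n m (gram smul \<alpha> v \<beta>)"
proof -
  obtain p i where "p < r" "i < n" "\<alpha> $$ (p, i) \<noteq> 0"
    using nz c by (metis carrier_matD eq_matI index_zero_mat)
  then have "0 < (cmod (\<alpha> $$ (p, i)))\<^sup>2" by simp
  also have "\<dots> \<le> trace_sum n m (gram smul \<alpha> v \<beta>)"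
    by (rule trace_sum_gram_ge_entry[OF c]) fact+
  finally show ?thesis .
qed

lemma trace_sum_sum: "trace_sum n m (\<Sum>k\<in>I. p k) = (\<Sum>k\<in>I. trace_sum n m (p k))"
proof -
  have "(\<Sum>i<n. Re (fst (\<Sum>k\<in>I. p k) (i, i))) = (\<Sum>i<n. \<Sum>k\<in>I. Re (fst (p k) (i, i)))"
    by (simp add: fst_sum sum_fun_apply)
  moreover have "(\<Sum>j<m. Re (fst (snd (\<Sum>k\<in>I. p k)) (j, j))) = (\<Sum>j<m. \<Sum>k\<in>I. Re (fst (snd (p k)) (j, j)))"
    by (simp add: fst_sum snd_sum sum_fun_apply)
  ultimately show ?thesis
    by (simp add: trace_sum_def sum.distrib sum.swap[of _ I])
qed

lemma trace_sum_scale: "trace_sum n m (scale_triple smul c p) = c * trace_sum n m p"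
  by (simp add: trace_sum_def scale_triple_def sum_distrib_left distrib_left)

text \<open>Bounding the sizes by \<open>n\<close> and \<open>m\<close> makes this a finite union,
  and right invertible coefficients have such sizes. Zero and other singular coefficients are
  included because right invertibility is not a closed condition.\<close>

definition gram_set ::
  "(complex \<Rightarrow> 'v::ab_group_add \<Rightarrow> 'v) \<Rightarrow> (nat \<Rightarrow> nat \<Rightarrow> 'v mat set) \<Rightarrow> nat \<Rightarrow> nat \<Rightarrow>
    ((nat \<times> nat \<Rightarrow> complex) \<times> (nat \<times> nat \<Rightarrow> complex) \<times> (nat \<times> nat \<Rightarrow> 'v)) set" where
  "gram_set smul K n m = (\<Union>r\<in>{1..n}. \<Union>s\<in>{1..m}. {p. \<exists>\<alpha>\<in>carrier_mat r n. \<exists>v\<in>K r s. \<exists>\<beta>\<in>carrier_mat s m.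
     p = gram smul \<alpha> v \<beta> \<and> trace_sum n m p = real (n + m)})"

text \<open>The number of terms, their sizes and their traces are unrestricted, so that addition is
  concatenation and scaling acts on the coefficients.\<close>

definition gram_cone ::
  "(complex \<Rightarrow> 'v::ab_group_add \<Rightarrow> 'v) \<Rightarrow> (nat \<Rightarrow> nat \<Rightarrow> 'v mat set) \<Rightarrow> nat \<Rightarrow> nat \<Rightarrow>
    ((nat \<times> nat \<Rightarrow> complex) \<times> (nat \<times> nat \<Rightarrow> complex) \<times> (nat \<times> nat \<Rightarrow> 'v)) set" where
  "gram_cone smul L n m = {p. \<exists>l r s \<alpha> v \<beta>. combination_data L n m l r s \<alpha> v \<beta> \<and>
     p = (\<Sum>k<l. gram smul (\<alpha> k) (v k) (\<beta> k))}"

text \<open>The formation of triples as an entrywise formula on arbitrary functions, where its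
  continuity can be stated on the whole space.\<close>

definition gram_functions ::
  "(complex \<Rightarrow> 'v::ab_group_add \<Rightarrow> 'v) \<Rightarrow> nat \<Rightarrow> nat \<Rightarrow> nat \<Rightarrow> nat \<Rightarrow>
    (nat \<times> nat \<Rightarrow> complex) \<times> (nat \<times> nat \<Rightarrow> complex) \<times> (nat \<times> nat \<Rightarrow> 'v) \<Rightarrow>
    (nat \<times> nat \<Rightarrow> complex) \<times> (nat \<times> nat \<Rightarrow> complex) \<times> (nat \<times> nat \<Rightarrow> 'v)" where
  "gram_functions smul r s n m p =
    ((\<lambda>(i, j). if i < n \<and> j < n then \<Sum>k<r. cnj (fst p (k, i)) * fst p (k, j) else 0),
     (\<lambda>(i, j). if i < m \<and> j < m then \<Sum>k<s. cnj (fst (snd p) (k, i)) * fst (snd p) (k, j) else 0),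
     (\<lambda>(i, j). if i < n \<and> j < m then \<Sum>k<r. \<Sum>q<s. smul (cnj (fst p (k, i)) * fst (snd p) (q, j)) (snd (snd p) (k, q)) else 0))"

lemma gram_eq_gram_functions:
  assumes c: "\<alpha> \<in> carrier_mat r n" "v \<in> carrier_mat r s" "\<beta> \<in> carrier_mat s m"
  shows "gram smul \<alpha> v \<beta> = gram_functions smul r s n m (mat_fun \<alpha>, mat_fun \<beta>, mat_fun v)"
proof -
  have 1: "mat_fun (mat_adjoint \<gamma> * \<gamma>) (i, j) =
      (if i < n \<and> j < n then \<Sum>k<r. cnj (mat_fun \<gamma> (k, i)) * mat_fun \<gamma> (k, j) else 0)"
    if "\<gamma> \<in> carrier_mat r n" for \<gamma> r n i j
    using that by (auto simp: mat_fun_apply[OF gram_carrier[OF that]] index_gram_mat mat_fun_apply[OF that]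
        simp del: index_mult_mat(1))
  have 2: "mat_fun (compress smul \<alpha> v \<beta>) (i, j) =
      (if i < n \<and> j < m then \<Sum>k<r. \<Sum>q<s. smul (cnj (mat_fun \<alpha> (k, i)) * mat_fun \<beta> (q, j)) (mat_fun v (k, q)) else 0)"
    for i j
    by (simp add: mat_fun_apply[OF compress_carrier[OF c(1,3)]] index_compress[OF c] mat_fun_apply[OF c(1)]
        mat_fun_apply[OF c(2)] mat_fun_apply[OF c(3)])
  show ?thesis
    by (simp add: gram_def gram_functions_def fun_eq_iff 1[OF c(1)] 1[OF c(3)] 2)
qed

section \<open>Compactness of the normalized triples\<close>

lemma continuous_on_triple_coordinates:
  "continuous_on S (\<lambda>p. fst p i)" "continuous_on S (\<lambda>p. fst (snd p) i)" "continuous_on S (\<lambda>p. snd (snd p) i)"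
  by (rule continuous_on_product_then_coordinatewise, intro continuous_intros)+

lemma continuous_on_matrix_entries:
  assumes "\<And>i j. Q i j \<Longrightarrow> continuous_on S (\<lambda>p. f p i j)"
  shows "continuous_on S (\<lambda>p. \<lambda>(i, j). if Q i j then f p i j else 0)"
proof (rule continuous_on_coordinatewise_then_product)
  fix x
  show "continuous_on S (\<lambda>p. (\<lambda>(i, j). if Q i j then f p i j else 0) x)"
    using assms[of "fst x" "snd x"] by (cases "Q (fst x) (snd x)") (simp_all add: split_beta)
qed

lemma (in locally_convex_tvs) continuous_on_gram_functions:
  "continuous_on UNIV (gram_functions smul r s n m)"
  unfolding gram_functions_def
  by (intro continuous_on_Pair continuous_on_matrix_entries continuous_on_sum continuous_on_smul
      continuous_on_mult continuous_on_cnj continuous_on_triple_coordinates)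

text \<open>A product of compact factors, hence compact by Tychonoff. The factors \<open>{0}\<close>
  outside the rectangle ensure that every member comes from a matrix.\<close>

definition entry_box :: "nat \<Rightarrow> nat \<Rightarrow> real \<Rightarrow> (nat \<times> nat \<Rightarrow> complex) set" where
  "entry_box r n M = Pi\<^sub>E UNIV (\<lambda>(p, i). if p < r \<and> i < n then {z. \<bar>Re z\<bar> \<le> M \<and> \<bar>Im z\<bar> \<le> M} else {0})"

lemma compact_entry_box: "compact (entry_box r n M)"
proof -
  have "compact ((\<lambda>p. Complex (fst p) (snd p)) ` ({- M..M} \<times> {- M..M}))"
    by (intro compact_continuous_image compact_Times compact_Icc)
      (simp add: Complex_eq, intro continuous_intros)
  also have "(\<lambda>p. Complex (fst p) (snd p)) ` ({- M..M} \<times> {- M..M}) = {z. \<bar>Re z\<bar> \<le> M \<and> \<bar>Im z\<bar> \<le> M}"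
    by (auto simp: abs_le_iff image_iff complex_eq_iff)
  finally have "compact (if p < r \<and> i < n then {z. \<bar>Re z\<bar> \<le> M \<and> \<bar>Im z\<bar> \<le> M} else {0::complex})" for p i
    by simp
  then have "compactin (product_topology (\<lambda>_. euclidean) UNIV) (entry_box r n M)"
    unfolding entry_box_def compactin_PiE by auto
  then show ?thesis by (simp add: euclidean_product_topology)
qed

lemma mat_fun_in_entry_box:
  assumes c: "\<alpha> \<in> carrier_mat r n" and le: "\<And>p i. p < r \<Longrightarrow> i < n \<Longrightarrow> cmod (\<alpha> $$ (p, i)) \<le> M"
  shows "mat_fun \<alpha> \<in> entry_box r n M"
proof -
  have "mat_fun \<alpha> (p, i) \<in> (if p < r \<and> i < n then {z. \<bar>Re z\<bar> \<le> M \<and> \<bar>Im z\<bar> \<le> M} else {0})" for p i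
  proof (cases "p < r \<and> i < n")
    case True
    then have "cmod (\<alpha> $$ (p, i)) \<le> M" by (simp add: le)
    then have "\<bar>Re (\<alpha> $$ (p, i))\<bar> \<le> M" "\<bar>Im (\<alpha> $$ (p, i))\<bar> \<le> M"
      using abs_Re_le_cmod[of "\<alpha> $$ (p, i)"] abs_Im_le_cmod[of "\<alpha> $$ (p, i)"] by linarith+
    then show ?thesis using True by (simp add: mat_fun_apply[OF c])
  next
    case False
    then show ?thesis by (auto simp: mat_fun_apply[OF c])
  qed
  then show ?thesis by (simp add: entry_box_def PiE_iff split_beta)
qed

lemma entry_box_mat_fun:
  assumes f: "f \<in> entry_box r n M"
  shows "mat_fun (mat r n f) = f"
proof (rule ext)
  fix x
  have "f x \<in> (case x of (p, i) \<Rightarrow> if p < r \<and> i < n then {z. \<bar>Re z\<bar> \<le> M \<and> \<bar>Im z\<bar> \<le> M} else {0})"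
    using f unfolding entry_box_def by (rule PiE_mem) simp
  then show "mat_fun (mat r n f) x = f x"
    by (cases x) (simp add: mat_fun_def split: if_split_asm)
qed

text \<open>For fixed sizes the normalized triples are the continuous image of bounded coefficients
  and a compact level of \<open>K\<close>, cut down by a closed trace condition.\<close>

lemma (in locally_convex_tvs) compact_gram_set:
  assumes K: "rect_matrix_convex smul K" and cK: "compact_collection K" and pos: "0 < n" "0 < m"
  shows "compact (gram_set smul K n m)"
  unfolding gram_set_def
proof (intro compact_UN finite_atLeastAtMost)
  fix r s assume "r \<in> {1..n}" "s \<in> {1..m}"
  then have rs: "0 < r" "0 < s" by auto
  have Kc: "v \<in> carrier_mat r s" if "v \<in> K r s" for v
    using rect_matrix_convex_carrier[OF K that] rs by simp
  define M where "M = real (n + m)"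
  let ?\<Phi> = "gram_functions smul r s n m"
  let ?B = "entry_box r n M \<times> entry_box s m M \<times> mat_fun ` K r s"
  have M1: "1 \<le> M" using pos by (simp add: M_def)
  \<comment> \<open>The trace bounds the squares of the entries by \<open>M\<close>; as
    \<open>M\<close> is at least 1, the entries themselves are bounded by \<open>M\<close>.\<close>
  have le: "x \<le> M" if "x\<^sup>2 \<le> M" for x
  proof (rule ccontr)
    assume "\<not> x \<le> M"
    then have "M < x" by simp
    with M1 have "M * 1 < x * x" by (intro mult_strict_mono) auto
    then show False using that by (simp add: power2_eq_square)
  qed
  have "{p. \<exists>\<alpha>\<in>carrier_mat r n. \<exists>v\<in>K r s. \<exists>\<beta>\<in>carrier_mat s m.
      p = gram smul \<alpha> v \<beta> \<and> trace_sum n m p = real (n + m)} = ?\<Phi> ` (?B \<inter> {q. trace_sum n m (?\<Phi> q) = M})"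
    (is "?L = ?R")
  proof (intro equalityI subsetI)
    fix p assume "p \<in> ?L"
    then obtain \<alpha> v \<beta> where *: "\<alpha> \<in> carrier_mat r n" "v \<in> K r s" "\<beta> \<in> carrier_mat s m"
      "p = gram smul \<alpha> v \<beta>" "trace_sum n m p = M"
      by (auto simp: M_def)
    have p: "p = ?\<Phi> (mat_fun \<alpha>, mat_fun \<beta>, mat_fun v)"
      using gram_eq_gram_functions[OF *(1) Kc[OF *(2)] *(3)] *(4) by simp
    have tr: "trace_sum n m (gram smul \<alpha> v \<beta>) = M"
      using *(5) by (simp only: *(4))
    note entries = trace_sum_gram_ge_entry[OF *(1,3), where smul = smul and v = v, unfolded tr]
    have "mat_fun \<alpha> \<in> entry_box r n M" "mat_fun \<beta> \<in> entry_box s m M"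
      by (rule mat_fun_in_entry_box[OF *(1) le[OF entries(1)]], assumption+)
        (rule mat_fun_in_entry_box[OF *(3) le[OF entries(2)]], assumption+)
    moreover have "trace_sum n m (?\<Phi> (mat_fun \<alpha>, mat_fun \<beta>, mat_fun v)) = M"
      using *(5) by (simp only: p)
    ultimately show "p \<in> ?R"
      using *(2) unfolding p by (intro imageI) auto
  next
    fix p assume "p \<in> ?R"
    then obtain a b v where *: "a \<in> entry_box r n M" "b \<in> entry_box s m M" "v \<in> K r s"
      "p = ?\<Phi> (a, b, mat_fun v)" "trace_sum n m p = M" by auto
    then have "p = gram smul (mat r n a) v (mat s m b)"
      using gram_eq_gram_functions[of "mat r n a" r n v s "mat s m b" m smul] Kc[OF *(3)]
      by (simp add: entry_box_mat_fun)
    then show "p \<in> ?L" using *(3,5) unfolding M_def by fastforce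
  qed
  moreover have "compact \<dots>"
  proof (rule compact_continuous_image)
    show "continuous_on (?B \<inter> {q. trace_sum n m (?\<Phi> q) = M}) ?\<Phi>"
      using continuous_on_gram_functions by (rule continuous_on_subset) simp
    have cont: "continuous_on UNIV (\<lambda>q. fst (?\<Phi> q) i)" "continuous_on UNIV (\<lambda>q. fst (snd (?\<Phi> q)) i)" for i
      by (rule continuous_on_product_then_coordinatewise, intro continuous_on_fst continuous_on_snd continuous_on_gram_functions)+
    have "continuous_on UNIV (\<lambda>q. trace_sum n m (?\<Phi> q))"
      unfolding trace_sum_def by (intro continuous_on_add continuous_on_sum continuous_on_Re cont)
    then have "closed {q. trace_sum n m (?\<Phi> q) = M}"
      by (intro closed_Collect_eq continuous_on_const)
    moreover have "compact ?B"
      using cK rs unfolding compact_collection_def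
      by (intro compact_Times compact_entry_box compact_mat_fun_image[where n = r and m = s]) auto
    ultimately show "compact (?B \<inter> {q. trace_sum n m (?\<Phi> q) = M})"
      by (rule compact_Int_closed[rotated])
  qed
  ultimately show "compact {p. \<exists>\<alpha>\<in>carrier_mat r n. \<exists>v\<in>K r s. \<exists>\<beta>\<in>carrier_mat s m.
      p = gram smul \<alpha> v \<beta> \<and> trace_sum n m p = real (n + m)}" by simp
qed

section \<open>The convex cone of sums of triples\<close>

definition append_seq :: "nat \<Rightarrow> (nat \<Rightarrow> 'a) \<Rightarrow> (nat \<Rightarrow> 'a) \<Rightarrow> nat \<Rightarrow> 'a" where
  "append_seq l f g k = (if k < l then f k else g (k - l))"

lemma sum_append_seq:
  fixes F :: "nat \<Rightarrow> 'a::comm_monoid_add"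
  assumes "\<And>k. k < l1 \<Longrightarrow> F k = f k" "\<And>k. k < l2 \<Longrightarrow> F (l1 + k) = g k"
  shows "(\<Sum>k<l1 + l2. F k) = (\<Sum>k<l1. f k) + (\<Sum>k<l2. g k)"
proof -
  have "(\<Sum>k<l1 + l2. F k) = (\<Sum>k<l1. F k) + (\<Sum>k<l2. F (l1 + k))"
    by (induction l2) (simp_all add: add.assoc)
  then show ?thesis using assms by simp
qed

lemma gram_cone_add:
  assumes "p \<in> gram_cone smul L n m" "q \<in> gram_cone smul L n m"
  shows "p + q \<in> gram_cone smul L n m"
proof -
  obtain l1 r1 s1 \<alpha>1 v1 \<beta>1 where 1: "combination_data L n m l1 r1 s1 \<alpha>1 v1 \<beta>1"
    "p = (\<Sum>k<l1. gram smul (\<alpha>1 k) (v1 k) (\<beta>1 k))"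
    using assms(1) unfolding gram_cone_def by blast
  obtain l2 r2 s2 \<alpha>2 v2 \<beta>2 where 2: "combination_data L n m l2 r2 s2 \<alpha>2 v2 \<beta>2"
    "q = (\<Sum>k<l2. gram smul (\<alpha>2 k) (v2 k) (\<beta>2 k))"
    using assms(2) unfolding gram_cone_def by blast
  let ?\<alpha> = "append_seq l1 \<alpha>1 \<alpha>2" and ?v = "append_seq l1 v1 v2" and ?\<beta> = "append_seq l1 \<beta>1 \<beta>2"
  have "combination_data L n m (l1 + l2) (append_seq l1 r1 r2) (append_seq l1 s1 s2) ?\<alpha> ?v ?\<beta>"
    using 1(1) 2(1) unfolding combination_data_def append_seq_def
    by (auto simp: less_diff_conv2 not_less add.commute)
  moreover have "p + q = (\<Sum>k<l1 + l2. gram smul (?\<alpha> k) (?v k) (?\<beta> k))"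
    unfolding 1(2) 2(2) by (rule sum_append_seq[symmetric]) (auto simp: append_seq_def)
  ultimately show ?thesis unfolding gram_cone_def by blast
qed

lemma gram_cone_scale:
  assumes vs: "vector_space smul" and L: "rect_matrix_convex smul L"
    and t: "0 \<le> t" and p: "p \<in> gram_cone smul L n m"
  shows "scale_triple smul t p \<in> gram_cone smul L n m"
proof -
  obtain l r s \<alpha> v \<beta> where 1: "combination_data L n m l r s \<alpha> v \<beta>"
    "p = (\<Sum>k<l. gram smul (\<alpha> k) (v k) (\<beta> k))"
    using p unfolding gram_cone_def by blast
  interpret vector_space smul by fact
  have car: "\<alpha> k \<in> carrier_mat (r k) n" "v k \<in> carrier_mat (r k) (s k)" "\<beta> k \<in> carrier_mat (s k) m" if "k < l" for k
    using 1(1) that rect_matrix_convex_carrier[OF L] by (auto simp: combination_data_def)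
  have "scale_triple smul t p = (\<Sum>k<l. scale_triple smul t (gram smul (\<alpha> k) (v k) (\<beta> k)))"
    unfolding 1(2) scale_triple_def
    by (simp add: prod_eq_iff fst_sum snd_sum fun_eq_iff sum_fun_apply scaleR_sum_right scale_sum_right)
  also have "\<dots> = (\<Sum>k<l. gram smul (of_real (sqrt t) \<cdot>\<^sub>m \<alpha> k) (v k) (of_real (sqrt t) \<cdot>\<^sub>m \<beta> k))"
    by (intro sum.cong refl gram_scale[OF vs t car, symmetric]) auto
  finally have "scale_triple smul t p = \<dots>" .
  moreover have "combination_data L n m l r s (\<lambda>k. of_real (sqrt t) \<cdot>\<^sub>m \<alpha> k) v (\<lambda>k. of_real (sqrt t) \<cdot>\<^sub>m \<beta> k)"
    using 1(1) by (auto simp: combination_data_def)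
  ultimately show ?thesis unfolding gram_cone_def by blast
qed

lemma gram_in_cone:
  assumes "\<alpha> \<in> carrier_mat r n" "v \<in> L r s" "\<beta> \<in> carrier_mat s m" "0 < r" "0 < s"
  shows "gram smul \<alpha> v \<beta> \<in> gram_cone smul L n m"
  unfolding gram_cone_def mem_Collect_eq
  by (intro exI[of _ 1] exI[of _ "\<lambda>_. r"] exI[of _ "\<lambda>_. s"] exI[of _ "\<lambda>_. \<alpha>"] exI[of _ "\<lambda>_. v"] exI[of _ "\<lambda>_. \<beta>"])
    (use assms in \<open>auto simp: combination_data_def\<close>)

text \<open>The rescaling of a combination into \<open>L n m\<close> is a continuous map
  \<open>g\<close> of the triple. It sends the cone into a closed set, hence also the closure of the
  cone, and it returns the third component unchanged when the first two are identities.\<close>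

lemma (in locally_convex_tvs) mem_if_unit_in_closure_gram_cone:
  assumes L: "rect_matrix_convex smul L" and closed: "closed_collection L" and pos: "0 < n" "0 < m"
    and v: "v \<in> carrier_mat n m"
    and mem: "(mat_fun (1\<^sub>m n), mat_fun (1\<^sub>m m), mat_fun v) \<in> closure (gram_cone smul L n m)"
  shows "v \<in> L n m"
proof -
  have vs: "vector_space smul" by (rule vector_space_axioms)
  define c where "c = (\<lambda>p :: (nat \<times> nat \<Rightarrow> complex) \<times> (nat \<times> nat \<Rightarrow> complex) \<times> (nat \<times> nat \<Rightarrow> 'v).
    1 / sqrt (unit_norm_bound n (fst p)) * (1 / sqrt (unit_norm_bound m (fst (snd p)))))"
  define g where "g = (\<lambda>p i. smul (of_real (c p)) (snd (snd p) i))"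
  have pos1: "unit_norm_bound n f > 0" for n f
    using unit_norm_bound_ge_1[of n f] by linarith
  note coord = continuous_on_triple_coordinates
  have N1: "continuous_on UNIV (\<lambda>p :: (nat \<times> nat \<Rightarrow> complex) \<times> (nat \<times> nat \<Rightarrow> complex) \<times> (nat \<times> nat \<Rightarrow> 'v).
      unit_norm_bound n (fst p))"
    unfolding unit_norm_bound_def
    by (intro continuous_on_add continuous_on_sum continuous_on_norm continuous_on_diff continuous_on_const coord)
  have N2: "continuous_on UNIV (\<lambda>p :: (nat \<times> nat \<Rightarrow> complex) \<times> (nat \<times> nat \<Rightarrow> complex) \<times> (nat \<times> nat \<Rightarrow> 'v).
      unit_norm_bound m (fst (snd p)))"
    unfolding unit_norm_bound_def
    by (intro continuous_on_add continuous_on_sum continuous_on_norm continuous_on_diff continuous_on_const coord)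
  have "continuous_on UNIV c"
    unfolding c_def
    by (intro continuous_on_mult continuous_on_divide continuous_on_const continuous_on_real_sqrt N1 N2)
      (use pos1 in \<open>auto simp: less_imp_neq[symmetric]\<close>)
  then have "continuous_on UNIV g"
    unfolding g_def
    by (intro continuous_on_coordinatewise_then_product continuous_on_smul continuous_on_of_real coord)
  moreover have "closed {f. mat n m f \<in> L n m}"
    using closed pos unfolding closed_collection_def by (intro closed_mat_preimage) auto
  ultimately have "closed (g -` {f. mat n m f \<in> L n m})"
    by (metis closed_vimage)
  moreover have "gram_cone smul L n m \<subseteq> g -` {f. mat n m f \<in> L n m}"
  proof
    fix p assume "p \<in> gram_cone smul L n m"
    then obtain l r s \<alpha> v \<beta> where 1: "combination_data L n m l r s \<alpha> v \<beta>"
      "p = (\<Sum>k<l. gram smul (\<alpha> k) (v k) (\<beta> k))"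
      unfolding gram_cone_def by blast
    define A B w where "A = mat_sum n n l (\<lambda>k. mat_adjoint (\<alpha> k) * \<alpha> k)"
      and "B = mat_sum m m l (\<lambda>k. mat_adjoint (\<beta> k) * \<beta> k)"
      and "w = mat_sum n m l (\<lambda>k. compress smul (\<alpha> k) (v k) (\<beta> k))"
    have car: "A \<in> carrier_mat n n" "B \<in> carrier_mat m m" "w \<in> carrier_mat n m"
      by (simp_all add: A_def B_def w_def)
    have p: "p = (mat_fun A, mat_fun B, mat_fun w)"
      unfolding 1(2) A_def B_def w_def
      using 1(1) by (intro sum_gram) (auto simp: combination_data_def)
    have N: "unit_norm_bound k (mat_fun X) = unit_norm_bound k (($$) X)" if "X \<in> carrier_mat k k" for X k
      by (simp add: unit_norm_bound_def mat_fun_apply[OF that])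
    have "mat n m (g p) = map_mat (smul (of_real (c p))) w"
      by (intro eq_matI) (use car in \<open>auto simp: g_def p mat_fun_apply[OF car(3)]\<close>)
    moreover have "c p = 1 / sqrt (unit_norm_bound n (($$) A)) * (1 / sqrt (unit_norm_bound m (($$) B)))"
      by (simp add: c_def p N car)
    ultimately have "mat n m (g p) \<in> L n m"
      using rect_matrix_convex_normalized[OF vs L pos 1(1)] by (simp only: A_def B_def w_def)
    then show "p \<in> g -` {f. mat n m f \<in> L n m}" by simp
  qed
  ultimately have "mat n m (g (mat_fun (1\<^sub>m n), mat_fun (1\<^sub>m m), mat_fun v)) \<in> L n m"
    using closure_minimal mem by blast
  moreover have "unit_norm_bound k (mat_fun (1\<^sub>m k)) = 1" for k
    by (simp add: unit_norm_bound_def mat_fun_def)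
  then have "g (mat_fun (1\<^sub>m n), mat_fun (1\<^sub>m m), mat_fun v) = mat_fun v"
    by (simp add: g_def c_def)
  ultimately show ?thesis by (simp add: mat_mat_fun[OF v])
qed

subsection \<open>Extreme triples\<close>

lemma compress_map_mat:
  assumes "vector_space smul" and c: "\<alpha> \<in> carrier_mat r n" "v \<in> carrier_mat r s" "\<beta> \<in> carrier_mat s m"
  shows "compress smul \<alpha> (map_mat (smul c) v) \<beta> = map_mat (smul c) (compress smul \<alpha> v \<beta>)"
proof (rule eq_matI)
  interpret vector_space smul by fact
  fix i j assume "i < dim_row (map_mat (smul c) (compress smul \<alpha> v \<beta>))"
    "j < dim_col (map_mat (smul c) (compress smul \<alpha> v \<beta>))"
  then have ij: "i < n" "j < m" using c by auto
  have "map_mat (smul c) v \<in> carrier_mat r s" using c by simp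
  from index_compress[OF c(1) this c(3) ij] index_compress[OF c ij]
  show "compress smul \<alpha> (map_mat (smul c) v) \<beta> $$ (i, j) = map_mat (smul c) (compress smul \<alpha> v \<beta>) $$ (i, j)"
    using c ij by (simp add: scale_sum_right mult.commute)
qed (use c in auto)

text \<open>Cancelling \<alpha> by its right inverse would give \<gamma> = 0, which has no right
  inverse at positive size. This makes the weights of a decomposed triple positive.\<close>

lemma right_invertible_mult_nonzero:
  fixes \<gamma> \<alpha> :: "complex mat"
  assumes c: "\<gamma> \<in> carrier_mat r' r" "\<alpha> \<in> carrier_mat r n" and pos: "0 < r'"
    and ri: "right_invertible_mat \<gamma>" "right_invertible_mat \<alpha>"
  shows "\<gamma> * \<alpha> \<noteq> 0\<^sub>m r' n"
proof
  assume 0: "\<gamma> * \<alpha> = 0\<^sub>m r' n"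
  obtain A where A: "A \<in> carrier_mat n r" "\<alpha> * A = 1\<^sub>m r"
    using ri(2) c by (auto simp: right_invertible_mat_def inverts_mat_def)
  obtain G where G: "G \<in> carrier_mat r r'" "\<gamma> * G = 1\<^sub>m r'"
    using ri(1) c by (auto simp: right_invertible_mat_def inverts_mat_def)
  have "\<gamma> = \<gamma> * (\<alpha> * A)" using A c by simp
  also have "\<dots> = (\<gamma> * \<alpha>) * A" using A c by (intro assoc_mult_mat[symmetric]) auto
  also have "\<dots> = 0\<^sub>m r' r" using A 0 by simp
  finally have "1\<^sub>m r' = (0\<^sub>m r' r' :: complex mat)" using G by simp
  then have "(1\<^sub>m r' :: complex mat) $$ (0, 0) = 0\<^sub>m r' r' $$ (0, 0)" by (rule arg_cong)
  then show False using pos by simp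
qed

text \<open>Right invertibility bounds the number of rows by the number of columns, and the left
  inverse of the rescaled matrix bounds it from below, so the matrix is square.\<close>

lemma scaled_isometry_unitary:
  fixes \<gamma> :: "complex mat"
  assumes c: "\<gamma> \<in> carrier_mat r' r" and ri: "right_invertible_mat \<gamma>" and t: "0 < t"
    and g: "mat_adjoint \<gamma> * \<gamma> = of_real t \<cdot>\<^sub>m 1\<^sub>m r"
  shows "r' = r" "unitary_mat r (of_real (1 / sqrt t) \<cdot>\<^sub>m \<gamma>)"
proof -
  have "r' \<le> r" using right_invertible_mat_dim_le[OF ri] c by simp
  define u where "u = complex_of_real (1 / sqrt t) \<cdot>\<^sub>m \<gamma>"
  have u: "u \<in> carrier_mat r' r" using c by (simp add: u_def)
  have "cnj (complex_of_real (1 / sqrt t)) * complex_of_real (1 / sqrt t) * of_real t = 1"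
    using t by (simp flip: of_real_mult)
  then have uu: "mat_adjoint u * u = 1\<^sub>m r"
    unfolding u_def gram_smult g by (intro eq_matI) auto
  have "r \<le> r'" using right_inverse_dim_le[OF carrier_mat_adjoint[OF u] u uu] .
  then show "r' = r" using \<open>r' \<le> r\<close> by simp
  then have u: "u \<in> carrier_mat r r" using u by simp
  have "u * mat_adjoint u = 1\<^sub>m r"
    using mat_mult_left_right_inverse[OF carrier_mat_adjoint[OF u] u uu] .
  then show "unitary_mat r (of_real (1 / sqrt t) \<cdot>\<^sub>m \<gamma>)"
    unfolding u_def[symmetric] using u uu by (simp add: unitary_mat_def inverts_mat_def)
qed

lemma unitary_mat_adjoint: "unitary_mat n u \<Longrightarrow> unitary_mat n (mat_adjoint u)"
  by (auto simp: unitary_mat_def)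

context locally_convex_tvs
begin

lemma cvx_gram_cone:
  assumes L: "rect_matrix_convex smul L"
  shows "real_lctvs.cvx (scale_triple smul) (gram_cone smul L n m)"
proof -
  have vs: "vector_space smul" by (rule vector_space_axioms)
  show ?thesis
    unfolding real_lctvs.cvx_def[OF real_lctvs_scale_triple]
    by (intro ballI gram_cone_add gram_cone_scale[OF vs L]) auto
qed

text \<open>Cutting a proper combination of \<open>v\<close> into its terms writes the triple of \<open>v\<close> as a convex
  combination of normalized triples, with the traces as weights.\<close>

lemma extremal_gram_imp_extreme_point:
  assumes K: "rect_matrix_convex smul K" and pos: "0 < n" "0 < m"
    and ext: "real_lctvs.extremal (scale_triple smul) (gram_set smul K n m) {gram smul \<alpha> v \<beta>}"
    and rs: "0 < r" "r \<le> n" "0 < s" "s \<le> m"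
    and c: "\<alpha> \<in> carrier_mat r n" "\<beta> \<in> carrier_mat s m" and v: "v \<in> K r s"
    and ri: "right_invertible_mat \<alpha>" "right_invertible_mat \<beta>"
    and tr: "trace_sum n m (gram smul \<alpha> v \<beta>) = real (n + m)"
  shows "v \<in> rect_matrix_extreme_points smul K r s"
  unfolding rect_matrix_extreme_points_def
proof (intro CollectI conjI allI impI v; elim conjE)
  have vs: "vector_space smul" by (rule vector_space_axioms)
  have vc: "v \<in> carrier_mat r s" by (rule rect_matrix_convex_carrier[OF K v rs(1,3)])
  let ?e = "gram smul \<alpha> v \<beta>"
  fix l \<rho> \<sigma> \<gamma> w \<delta> k
  assume pc: "proper_combination K r s l \<rho> \<sigma> \<gamma> w \<delta>"
    and sum: "mat_sum r s l (\<lambda>k. compress smul (\<gamma> k) (w k) (\<delta> k)) = v" and k: "k < l"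
  have d: "0 < \<rho> k" "0 < \<sigma> k" "w k \<in> K (\<rho> k) (\<sigma> k)" "\<gamma> k \<in> carrier_mat (\<rho> k) r" "\<delta> k \<in> carrier_mat (\<sigma> k) s"
    "right_invertible_mat (\<gamma> k)" "right_invertible_mat (\<delta> k)" if "k < l" for k
    using pc that by (auto simp: proper_combination_def combination_data_def)
  have wc: "w k \<in> carrier_mat (\<rho> k) (\<sigma> k)" if "k < l" for k
    using rect_matrix_convex_carrier[OF K d(3)[OF that] d(1,2)[OF that]] .
  have gg: "mat_sum r r l (\<lambda>k. mat_adjoint (\<gamma> k) * \<gamma> k) = 1\<^sub>m r" "mat_sum s s l (\<lambda>k. mat_adjoint (\<delta> k) * \<delta> k) = 1\<^sub>m s"
    using pc by (simp_all add: proper_combination_def)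
  have dim: "\<rho> k \<le> r" "\<sigma> k \<le> s" if "k < l" for k
    using right_invertible_mat_dim_le[OF d(6)[OF that]] right_invertible_mat_dim_le[OF d(7)[OF that]]
      d(4,5)[OF that] by auto
  \<comment> \<open>Substituting the combination for \<open>v\<close> in the triple gives these
    summands. Their Gram matrices add up correctly because those of \<gamma> and \<delta> add up to
    identities.\<close>
  define f where "f = (\<lambda>k. gram smul (\<gamma> k * \<alpha>) (w k) (\<delta> k * \<beta>))"
  have car: "\<gamma> k * \<alpha> \<in> carrier_mat (\<rho> k) n" "\<delta> k * \<beta> \<in> carrier_mat (\<sigma> k) m" if "k < l" for k
    using d(4,5)[OF that] c by auto
  have fk: "f k = (mat_fun (compress (*) \<alpha> (mat_adjoint (\<gamma> k) * \<gamma> k) \<alpha>), mat_fun (compress (*) \<beta> (mat_adjoint (\<delta> k) * \<delta> k) \<beta>),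
     mat_fun (compress smul \<alpha> (compress smul (\<gamma> k) (w k) (\<delta> k)) \<beta>))" if "k < l" for k
    unfolding f_def by (rule gram_mult[OF vs d(4)[OF that] wc[OF that] d(5)[OF that] c])
  have "(\<Sum>k<l. f k) = (mat_fun (compress (*) \<alpha> (1\<^sub>m r) \<alpha>), mat_fun (compress (*) \<beta> (1\<^sub>m s) \<beta>), mat_fun (compress smul \<alpha> v \<beta>))"
  proof -
    have "compress (*) \<alpha> (mat_sum r r l (\<lambda>k. mat_adjoint (\<gamma> k) * \<gamma> k)) \<alpha> =
        mat_sum n n l (\<lambda>k. compress (*) \<alpha> (mat_adjoint (\<gamma> k) * \<gamma> k) \<alpha>)"
      by (rule compress_mat_sum[OF vector_space_complex c(1,1)]) (rule gram_carrier[OF d(4)])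
    then have "mat_fun (compress (*) \<alpha> (1\<^sub>m r) \<alpha>) = (\<Sum>k<l. mat_fun (compress (*) \<alpha> (mat_adjoint (\<gamma> k) * \<gamma> k) \<alpha>))"
      by (simp only: gg(1) mat_fun_mat_sum compress_carrier[OF c(1,1)])
    moreover have "compress (*) \<beta> (mat_sum s s l (\<lambda>k. mat_adjoint (\<delta> k) * \<delta> k)) \<beta> =
        mat_sum m m l (\<lambda>k. compress (*) \<beta> (mat_adjoint (\<delta> k) * \<delta> k) \<beta>)"
      by (rule compress_mat_sum[OF vector_space_complex c(2,2)]) (rule gram_carrier[OF d(5)])
    then have "mat_fun (compress (*) \<beta> (1\<^sub>m s) \<beta>) = (\<Sum>k<l. mat_fun (compress (*) \<beta> (mat_adjoint (\<delta> k) * \<delta> k) \<beta>))"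
      by (simp only: gg(2) mat_fun_mat_sum compress_carrier[OF c(2,2)])
    moreover have "compress smul \<alpha> (mat_sum r s l (\<lambda>k. compress smul (\<gamma> k) (w k) (\<delta> k))) \<beta> =
        mat_sum n m l (\<lambda>k. compress smul \<alpha> (compress smul (\<gamma> k) (w k) (\<delta> k)) \<beta>)"
      by (rule compress_mat_sum[OF vs c]) (rule compress_carrier[OF d(4,5)])
    then have "mat_fun (compress smul \<alpha> v \<beta>) = (\<Sum>k<l. mat_fun (compress smul \<alpha> (compress smul (\<gamma> k) (w k) (\<delta> k)) \<beta>))"
      by (simp only: sum mat_fun_mat_sum compress_carrier[OF c])
    moreover have "(\<Sum>k<l. f k) = (\<Sum>k<l. mat_fun (compress (*) \<alpha> (mat_adjoint (\<gamma> k) * \<gamma> k) \<alpha>),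
      \<Sum>k<l. mat_fun (compress (*) \<beta> (mat_adjoint (\<delta> k) * \<delta> k) \<beta>),
      \<Sum>k<l. mat_fun (compress smul \<alpha> (compress smul (\<gamma> k) (w k) (\<delta> k)) \<beta>))"
      by (intro prod_eqI) (simp_all add: fst_sum snd_sum fk)
    ultimately show ?thesis by simp
  qed
  also have "\<dots> = ?e"
    by (simp add: gram_def gram_mat_eq_compress[OF c(1)] gram_mat_eq_compress[OF c(2)])
  finally have fsum: "(\<Sum>k<l. f k) = ?e" .
  define N where "N = real (n + m)"
  have N: "0 < N" using pos by (simp add: N_def)
  define t where "t = (\<lambda>k. trace_sum n m (f k) / N)"
  have t: "0 < t k" if "k < l" for k
  proof -
    have "\<gamma> k * \<alpha> \<noteq> 0\<^sub>m (\<rho> k) n"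
      by (rule right_invertible_mult_nonzero[OF d(4)[OF that] c(1) d(1)[OF that] d(6)[OF that] ri(1)])
    then show ?thesis
      unfolding t_def f_def by (intro divide_pos_pos[OF trace_sum_gram_pos[OF car[OF that]] N])
  qed
  have t1: "(\<Sum>k<l. t k) = 1"
    using N tr unfolding t_def sum_divide_distrib[symmetric] trace_sum_sum[symmetric] fsum N_def[symmetric] by simp
  \<comment> \<open>Dividing by the share \<open>t k\<close> of the trace restores the total trace
    \<open>n + m\<close>, which makes the sum of the \<open>f k\<close> a convex combination of
    normalized triples.\<close>
  define x where "x = (\<lambda>k. scale_triple smul (1 / t k) (f k))"
  interpret R: real_lctvs "scale_triple smul :: real \<Rightarrow> (nat \<times> nat \<Rightarrow> complex) \<times> (nat \<times> nat \<Rightarrow> complex) \<times> (nat \<times> nat \<Rightarrow> 'v) \<Rightarrow> _"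
    by (rule real_lctvs_scale_triple)
  have xf: "scale_triple smul (t k) (x k) = f k" if "k < l" for k
    using t[OF that] by (simp add: x_def)
  have "(\<Sum>k<l. scale_triple smul (t k) (x k)) = ?e"
    unfolding fsum[symmetric] by (intro sum.cong refl xf) simp
  moreover have "x k \<in> gram_set smul K n m" if "k < l" for k
  proof -
    have "x k = gram smul (of_real (sqrt (1 / t k)) \<cdot>\<^sub>m (\<gamma> k * \<alpha>)) (w k) (of_real (sqrt (1 / t k)) \<cdot>\<^sub>m (\<delta> k * \<beta>))"
      unfolding x_def f_def using t[OF that]
      by (intro gram_scale[OF vs _ car(1)[OF that] wc[OF that] car(2)[OF that], symmetric]) simp
    moreover have "trace_sum n m (f k) = t k * N" using N by (simp add: t_def)
    then have "trace_sum n m (x k) = real (n + m)"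
      using t[OF that] unfolding x_def trace_sum_scale by (simp add: N_def)
    moreover have "\<rho> k \<in> {1..n}" "\<sigma> k \<in> {1..m}"
      using d(1,2)[OF that] dim[OF that] rs by auto
    ultimately show ?thesis
      unfolding gram_set_def using car[OF that] d(3)[OF that]
      by (intro UN_I[of "\<rho> k"] UN_I[of "\<sigma> k"] CollectI bexI[of _ "of_real (sqrt (1 / t k)) \<cdot>\<^sub>m (\<gamma> k * \<alpha>)"]
          bexI[of _ "w k"] bexI[of _ "of_real (sqrt (1 / t k)) \<cdot>\<^sub>m (\<delta> k * \<beta>)"] conjI) auto
  qed
  ultimately have "x k \<in> {?e}"
    using R.extremalD[OF ext, of l t x k] t t1 k by simp
  then have fe: "f k = scale_triple smul (t k) ?e" using xf[OF k] by simp
  have scale: "scale_triple smul (t k) ?e = (mat_fun (compress (*) \<alpha> (of_real (t k) \<cdot>\<^sub>m 1\<^sub>m r) \<alpha>),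
      mat_fun (compress (*) \<beta> (of_real (t k) \<cdot>\<^sub>m 1\<^sub>m s) \<beta>), mat_fun (compress smul \<alpha> (map_mat (smul (of_real (t k))) v) \<beta>))"
    by (simp add: scale_triple_def gram_def gram_mat_eq_compress[OF c(1)] gram_mat_eq_compress[OF c(2)]
        smult_eq_map_mat compress_map_mat[OF vector_space_complex c(1) _ c(1)]
        compress_map_mat[OF vector_space_complex c(2) _ c(2)] compress_map_mat[OF vs c(1) vc c(2)]
        mat_fun_map_mat scaleR_conv_of_real)
  have eqs: "mat_fun (compress (*) \<alpha> (mat_adjoint (\<gamma> k) * \<gamma> k) \<alpha>) = mat_fun (compress (*) \<alpha> (of_real (t k) \<cdot>\<^sub>m 1\<^sub>m r) \<alpha>)"
    "mat_fun (compress (*) \<beta> (mat_adjoint (\<delta> k) * \<delta> k) \<beta>) = mat_fun (compress (*) \<beta> (of_real (t k) \<cdot>\<^sub>m 1\<^sub>m s) \<beta>)"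
    "mat_fun (compress smul \<alpha> (compress smul (\<gamma> k) (w k) (\<delta> k)) \<beta>) = mat_fun (compress smul \<alpha> (map_mat (smul (of_real (t k))) v) \<beta>)"
    using fe unfolding fk[OF k] scale prod.inject by blast+
  \<comment> \<open>Each summand is \<open>t k\<close> times the whole triple. Cancelling the right
    invertible \<alpha> and \<beta> transfers this proportionality to the combination of
    \<open>v\<close>.\<close>
  have \<gamma>: "mat_adjoint (\<gamma> k) * \<gamma> k = of_real (t k) \<cdot>\<^sub>m 1\<^sub>m r"
    by (rule compress_cancel[OF vector_space_complex c(1) gram_carrier[OF d(4)[OF k]] _ c(1) ri(1,1)
          eqs(1)[unfolded mat_fun_inject[OF compress_carrier[OF c(1,1)] compress_carrier[OF c(1,1)]]]]) simp
  have \<delta>: "mat_adjoint (\<delta> k) * \<delta> k = of_real (t k) \<cdot>\<^sub>m 1\<^sub>m s"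
    by (rule compress_cancel[OF vector_space_complex c(2) gram_carrier[OF d(5)[OF k]] _ c(2) ri(2,2)
          eqs(2)[unfolded mat_fun_inject[OF compress_carrier[OF c(2,2)] compress_carrier[OF c(2,2)]]]]) simp
  have w: "compress smul (\<gamma> k) (w k) (\<delta> k) = map_mat (smul (of_real (t k))) v"
    by (rule compress_cancel[OF vs c(1) compress_carrier[OF d(4,5)[OF k]] _ c(2) ri
          eqs(3)[unfolded mat_fun_inject[OF compress_carrier[OF c] compress_carrier[OF c]]]]) (use vc in simp)
  \<comment> \<open>This normalization turns \<gamma> and \<delta> into unitaries and cancels the
    factor \<open>t k\<close> in front of \<open>v\<close>; compressing with the adjoints then
    expresses \<open>w k\<close> through \<open>v\<close>.\<close>
  define a where "a = complex_of_real (1 / sqrt (t k))"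
  define U W where "U = a \<cdot>\<^sub>m \<gamma> k" and "W = a \<cdot>\<^sub>m \<delta> k"
  have r: "\<rho> k = r" and U: "unitary_mat r U"
    using scaled_isometry_unitary[OF d(4)[OF k] d(6)[OF k] t[OF k] \<gamma>] by (simp_all add: U_def a_def)
  have s: "\<sigma> k = s" and W: "unitary_mat s W"
    using scaled_isometry_unitary[OF d(5)[OF k] d(7)[OF k] t[OF k] \<delta>] by (simp_all add: W_def a_def)
  have Uc: "U \<in> carrier_mat r r" "mat_adjoint U \<in> carrier_mat r r" "U * mat_adjoint U = 1\<^sub>m r"
    using U by (auto simp: unitary_mat_def inverts_mat_def)
  have Wc: "W \<in> carrier_mat s s" "mat_adjoint W \<in> carrier_mat s s" "W * mat_adjoint W = 1\<^sub>m s"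
    using W by (auto simp: unitary_mat_def inverts_mat_def)
  have wk: "w k \<in> carrier_mat r s" using wc[OF k] r s by simp
  have "cnj a * a * of_real (t k) = 1"
    using t[OF k] unfolding a_def by (simp flip: of_real_mult)
  then have UwW: "compress smul U (w k) W = v"
    unfolding U_def W_def compress_smult[OF vs d(4)[OF k] wc[OF k] d(5)[OF k]] w
    by (intro eq_matI) (use vc in auto)
  have "w k = compress smul (U * mat_adjoint U) (w k) (W * mat_adjoint W)"
    unfolding Uc(3) Wc(3) by (rule compress_one[OF vs wk, symmetric])
  also have "\<dots> = compress smul (mat_adjoint U) v (mat_adjoint W)"
    unfolding UwW[symmetric] by (rule compress_compress[OF vs Uc(1) wk Wc(1) Uc(2) Wc(2), symmetric])
  finally have "w k = compress smul (mat_adjoint U) v (mat_adjoint W)" .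
  then show "\<exists>u wa. unitary_mat r u \<and> unitary_mat s wa \<and> w k = compress smul u v wa"
    using unitary_mat_adjoint[OF U] unitary_mat_adjoint[OF W] by blast
  show "\<rho> k = r" by (rule r)
  show "\<sigma> k = s" by (rule s)
qed

text \<open>A triple has many representations. One with right invertible coefficients exhibits an
  extreme point of \<open>K\<close>, and hence an element of \<open>L\<close>, in the
  middle.\<close>

lemma extremal_gram_in_cone:
  assumes K: "rect_matrix_convex smul K" and pos: "0 < n" "0 < m"
    and ext: "real_lctvs.extremal (scale_triple smul) (gram_set smul K n m) {e}"
    and L: "collection_le (rect_matrix_extreme_points smul K) L"
    and L0: "\<And>r s. 0 < r \<Longrightarrow> 0 < s \<Longrightarrow> 0\<^sub>m r s \<in> L r s"
  shows "e \<in> gram_cone smul L n m"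
proof -
  have vs: "vector_space smul" by (rule vector_space_axioms)
  have "e \<in> gram_set smul K n m"
    using ext unfolding real_lctvs.extremal_def[OF real_lctvs_scale_triple] by blast
  then obtain r s \<alpha> v \<beta> where rs: "0 < r" "0 < s"
    and c: "\<alpha> \<in> carrier_mat r n" "\<beta> \<in> carrier_mat s m" and v: "v \<in> K r s"
    and e: "e = gram smul \<alpha> v \<beta>" and tr: "trace_sum n m e = real (n + m)"
    unfolding gram_set_def by (auto simp: Suc_le_eq)
  have vc: "v \<in> carrier_mat r s" by (rule rect_matrix_convex_carrier[OF K v rs])
  show ?thesis
  proof (cases "\<alpha> = 0\<^sub>m r n \<or> \<beta> = 0\<^sub>m s m")
    case True
    \<comment> \<open>With a vanishing coefficient the triple does not depend on \<open>v\<close>,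
      so a zero matrix from \<open>L\<close> may take its place.\<close>
    then have "compress smul \<alpha> v \<beta> = 0\<^sub>m n m"
      using compress_zero_left[OF vs vc c(2)] compress_zero_right[OF vs vc c(1)] by auto
    then have "e = gram smul \<alpha> (0\<^sub>m r s) \<beta>"
      by (simp add: e gram_def compress_zero_middle[OF vs c])
    then show ?thesis by (simp only:) (intro gram_in_cone[where r = r and s = s] c rs L0)
  next
    case False
    obtain r' Q \<alpha>' where Q: "0 < r'" "Q \<in> carrier_mat r r'" "\<alpha>' \<in> carrier_mat r' n"
      "mat_adjoint Q * Q = 1\<^sub>m r'" "\<alpha> = Q * \<alpha>'" "right_invertible_mat \<alpha>'"
      using isometry_factorization[OF c(1)] False by blast
    obtain s' S \<beta>' where S: "0 < s'" "S \<in> carrier_mat s s'" "\<beta>' \<in> carrier_mat s' m"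
      "mat_adjoint S * S = 1\<^sub>m s'" "\<beta> = S * \<beta>'" "right_invertible_mat \<beta>'"
      using isometry_factorization[OF c(2)] False by blast
    define v' where "v' = compress smul Q v S"
    have v': "v' \<in> K r' s'"
      unfolding v'_def using Q S rs by (intro rect_matrix_convex_compress[OF K v]) auto
    have e': "e = gram smul \<alpha>' v' \<beta>'"
      unfolding e v'_def Q(5) S(5) by (rule gram_isometry[OF vs Q(2) vc S(2) Q(3) S(3) Q(4) S(4)])
    have "r' \<le> n" "s' \<le> m"
      using right_invertible_mat_dim_le[OF Q(6)] right_invertible_mat_dim_le[OF S(6)] Q(3) S(3) by auto
    then have "v' \<in> rect_matrix_extreme_points smul K r' s'"
      using ext tr Q S v' unfolding e'
      by (intro extremal_gram_imp_extreme_point[OF K pos, where \<alpha> = \<alpha>' and \<beta> = \<beta>']) auto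
    then have "v' \<in> L r' s'" using L Q(1) S(1) by (auto simp: collection_le_def)
    then show ?thesis unfolding e' by (intro gram_in_cone[where r = r' and s = s'] Q S)
  qed
qed

text \<open>Zero matrices in \<open>L\<close> are assumed here because of triples with a vanishing
  coefficient. The assumption can be verified for a suitable \<open>L\<close> before any extreme
  point of \<open>K\<close> is known.\<close>

lemma krein_milman_with_zero:
  assumes K: "rect_matrix_convex smul K" and cK: "compact_collection K"
    and L: "rect_matrix_convex smul L" "closed_collection L"
    and ext: "collection_le (rect_matrix_extreme_points smul K) L"
    and L0: "\<And>r s. 0 < r \<Longrightarrow> 0 < s \<Longrightarrow> 0\<^sub>m r s \<in> L r s"
  shows "collection_le K L"
  unfolding collection_le_def
proof (intro allI impI subsetI)
  fix n m :: nat and v assume pos: "0 < n" "0 < m" and v: "v \<in> K n m"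
  have vs: "vector_space smul" by (rule vector_space_axioms)
  have vc: "v \<in> carrier_mat n m" by (rule rect_matrix_convex_carrier[OF K v pos])
  have g: "gram smul (1\<^sub>m n) v (1\<^sub>m m) = (mat_fun (1\<^sub>m n), mat_fun (1\<^sub>m m), mat_fun v)"
    by (simp add: gram_def compress_one[OF vs vc])
  have "trace_sum n m (gram smul (1\<^sub>m n) v (1\<^sub>m m)) = real (n + m)"
    by (simp add: g trace_sum_def mat_fun_def)
  then have "gram smul (1\<^sub>m n) v (1\<^sub>m m) \<in> gram_set smul K n m"
    unfolding gram_set_def using pos v
    by (intro UN_I[of n] UN_I[of m] CollectI bexI[of _ "1\<^sub>m n"] bexI[of _ v] bexI[of _ "1\<^sub>m m"]) auto
  also have "gram_set smul K n m \<subseteq> closure (gram_cone smul L n m)"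
    by (rule real_lctvs.compact_subset_closure_convex[OF real_lctvs_scale_triple
        compact_gram_set[OF K cK pos] cvx_gram_cone[OF L(1)] extremal_gram_in_cone[OF K pos _ ext L0]])
  finally show "v \<in> L n m"
    unfolding g by (rule mem_if_unit_in_closure_gram_cone[OF L pos vc])
qed

section \<open>Existence of an extreme point\<close>

lemma rect_matrix_convex_zero_collection: "rect_matrix_convex smul (\<lambda>n m. {0\<^sub>m n m})"
  unfolding rect_matrix_convex_def
proof (intro conjI allI impI; (elim conjE)?)
  have vs: "vector_space smul" by (rule vector_space_axioms)
  show "collection_le (\<lambda>n m. {0\<^sub>m n m}) carrier_mat" by (auto simp: collection_le_def)
  fix n m l r s \<alpha> v \<beta>
  assume d: "combination_data (\<lambda>n m. {0\<^sub>m n m :: 'v mat}) n m l r s \<alpha> v \<beta>"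
  have "compress smul (\<alpha> k) (v k) (\<beta> k) = 0\<^sub>m n m" if "k < l" for k
    using d that by (auto simp: combination_data_def intro!: compress_zero_middle[OF vs])
  then show "mat_sum n m l (\<lambda>k. compress smul (\<alpha> k) (v k) (\<beta> k)) \<in> {0\<^sub>m n m}"
    by (auto intro!: eq_matI)
qed

lemma closed_zero_collection: "closed_collection (\<lambda>n m. {0\<^sub>m n m :: 'v mat})"
  unfolding closed_collection_def
  by (intro allI impI compactin_imp_closedin_mat_topology finite_imp_compactin) auto

text \<open>If there were none, the zero collection would vacuously contain all extreme points, so
  \<open>K\<close> would consist of zeros. But then \<open>K 1 1\<close> is a single point, and that
  point is extreme.\<close>

lemma exists_extreme_point:
  assumes K: "rect_matrix_convex smul K" and cK: "compact_collection K"
    and v: "v \<in> K n m" "0 < n" "0 < m"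
  shows "\<exists>r>0. \<exists>s>0. rect_matrix_extreme_points smul K r s \<noteq> {}"
proof (rule ccontr)
  have vs: "vector_space smul" by (rule vector_space_axioms)
  assume none: "\<not> ?thesis"
  then have "rect_matrix_extreme_points smul K r s = {}" if "0 < r" "0 < s" for r s
    using that by blast
  then have "collection_le (rect_matrix_extreme_points smul K) (\<lambda>n m. {0\<^sub>m n m})"
    by (simp add: collection_le_def)
  then have "collection_le K (\<lambda>n m. {0\<^sub>m n m})"
    by (intro krein_milman_with_zero[OF K cK rect_matrix_convex_zero_collection closed_zero_collection]) auto
  then have "K 1 1 \<subseteq> {0\<^sub>m 1 1}" by (simp add: collection_le_def)
  moreover have "0\<^sub>m 1 1 \<in> K 1 1" by (rule rect_matrix_convex_zero[OF vs K v]) simp_all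
  ultimately have K1: "K 1 1 = {0\<^sub>m 1 1}" by blast
  have "0\<^sub>m 1 1 \<in> rect_matrix_extreme_points smul K 1 1"
    unfolding rect_matrix_extreme_points_def
  proof (intro CollectI conjI allI impI; (elim conjE)?)
    show "0\<^sub>m 1 1 \<in> K 1 1" unfolding K1 by simp
    fix l r s \<alpha> w \<beta> k
    assume pc: "proper_combination K 1 1 l r s \<alpha> w \<beta>" and k: "k < l"
    have d: "0 < r k" "0 < s k" "w k \<in> K (r k) (s k)" "\<alpha> k \<in> carrier_mat (r k) 1" "\<beta> k \<in> carrier_mat (s k) 1"
      "right_invertible_mat (\<alpha> k)" "right_invertible_mat (\<beta> k)"
      using pc k by (auto simp: proper_combination_def combination_data_def)
    \<comment> \<open>A right invertible matrix with one column has at most one row, so no other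
      level can enter the combination.\<close>
    show r: "r k = 1" and s: "s k = 1"
      using right_invertible_mat_dim_le[OF d(6)] right_invertible_mat_dim_le[OF d(7)] d(1,2,4,5) by auto
    have one: "unitary_mat 1 (1\<^sub>m 1)" by (simp add: unitary_mat_def inverts_mat_def)
    have "w k = compress smul (1\<^sub>m 1) (0\<^sub>m 1 1) (1\<^sub>m 1)"
      using d(3) K1 r s compress_one[OF vs zero_carrier_mat] by simp
    with one show "\<exists>u wa. unitary_mat 1 u \<and> unitary_mat 1 wa \<and> w k = compress smul u (0\<^sub>m 1 1) wa"
      by blast
  qed
  then show False using none by auto
qed

end

theorem theorem3p8:
  fixes smul :: "complex \<Rightarrow> 'v::{topological_ab_group_add, t2_space} \<Rightarrow> 'v"
    and K :: "nat \<Rightarrow> nat \<Rightarrow> 'v mat set"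
  assumes "locally_convex_tvs smul"
    and "rect_matrix_convex smul K"
    and "compact_collection K"
  shows "is_closed_rect_matrix_convex_hull smul (rect_matrix_extreme_points smul K) K"
proof -
  interpret locally_convex_tvs smul by fact
  have vs: "vector_space smul" by (rule vector_space_axioms)
  have "closed_collection K"
    using assms(3) compactin_imp_closedin_mat_topology
    unfolding closed_collection_def compact_collection_def by blast
  moreover have "collection_le (rect_matrix_extreme_points smul K) K"
    by (auto simp: collection_le_def rect_matrix_extreme_points_def)
  moreover have "collection_le K L"
    if L: "rect_matrix_convex smul L" "closed_collection L" and ext: "collection_le (rect_matrix_extreme_points smul K) L" for L
  \<comment> \<open>If \<open>K\<close> is nonempty, an extreme point lies in \<open>L\<close> and
    supplies its zero matrices. An empty \<open>K\<close> is contained in every \<open>L\<close>,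
    even an empty one.\<close>
  proof (cases "\<exists>n>0. \<exists>m>0. K n m \<noteq> {}")
    case True
    then obtain n m v where "v \<in> K n m" "0 < n" "0 < m" by blast
    then obtain r s u where "0 < r" "0 < s" "u \<in> rect_matrix_extreme_points smul K r s"
      using exists_extreme_point[OF assms(2,3)] by blast
    then have "u \<in> L r s" using ext by (auto simp: collection_le_def)
    then have "0\<^sub>m r' s' \<in> L r' s'" if "0 < r'" "0 < s'" for r' s'
      using rect_matrix_convex_zero[OF vs L(1)] \<open>0 < r\<close> \<open>0 < s\<close> that by blast
    then show ?thesis by (rule krein_milman_with_zero[OF assms(2,3) L ext])
  next
    case False
    then show ?thesis unfolding collection_le_def by blast
  qed
  ultimately show ?thesis
    using assms(2) unfolding is_closed_rect_matrix_convex_hull_def by blast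
qed

end
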